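(* Let $n\ge 3$, and let $a$ and $b$ be non-zero elements of $\mathbb{C}_n^\perp\subset A_n$. Then the real dimension of the annihilator of $\{a,b\}$ in $A_{n+1}$ is equal to $\dim\mathrm{Ann}(a)+\dim\mathrm{Ann}(b)$ or to $\dim\mathrm{Ann}(a)+\dim\mathrm{Ann}(b)+4$.
   Context: The Cayley-Dickson algebras $A_n$ are real algebras with involution defined inductively: $A_0=\mathbb{R}$ with trivial conjugation, and $A_n=A_{n-1}\times A_{n-1}$ additively, with $(a,b)^*=(a^*,-b)$ and $(a,b)(c,d)=(ac-d^*b,\;da+bc^* )$. For $n\ge 1$ put $i_n=(0,1)\in A_n$, and let $\mathbb{C}_n$ be the $\mathbb{R}$-linear span of $1=(1,0)$ and $i_n$. The real inner product on $A_n$ is $\langle a,b\rangle_{\mathbb{R}}=\mathrm{Re}(ab^* )$, where $\mathrm{Re}(x)=\frac12(x+x^* )$; $\mathbb{C}_n^\perp$ is the orthogonal complement of $\mathbb{C}_n$ in $A_n$. For $a,b\in\mathbb{C}_n^\perp$, $\{a,b\}$ denotes the element $\frac{1}{\sqrt2}\big(a+b,\;i_n(-a+b)\big)$ of $A_{n+1}$. For an element $x$ of $A_m$, $\mathrm{Ann}(x)=\{y\in A_m: xy=0\}$. All dimensions are over $\mathbb{R}$. *)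

theory Defs
  imports "HOL-Analysis.Finite_Function_Topology"
begin

(* The algebras A_n for all n live in one ambient real vector space, the finitely supported
   sequences: A_n consists of those supported in {0..<2^n}. A pair (a, b) of elements of A_n is
   the concatenation of the coordinates of a and b, so (a, 0) is the same sequence as a.
   The multiplication that the library puts on this type (convolution) is not used. *)

type_synonym cd = "nat \<Rightarrow>\<^sub>0 real"

definition cd_carrier :: "nat \<Rightarrow> cd set" where
  "cd_carrier n = {x. \<forall>i\<ge>2 ^ n. Poly_Mapping.lookup x i = 0}"

lift_definition cd_pair :: "nat \<Rightarrow> cd \<Rightarrow> cd \<Rightarrow> cd"
  is "\<lambda>n a b i. if i < 2 ^ n then a i else b (i - 2 ^ n)"
proof -
  fix n :: nat and a b :: "nat \<Rightarrow> real"
  assume "finite {i. b i \<noteq> 0}"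
  then have "finite ({..<2 ^ n} \<union> (\<lambda>i. i + 2 ^ n) ` {i. b i \<noteq> 0})" by simp
  moreover have "{i. (if i < 2 ^ n then a i else b (i - 2 ^ n)) \<noteq> 0}
      \<subseteq> {..<2 ^ n} \<union> (\<lambda>i. i + 2 ^ n) ` {i. b i \<noteq> 0}"
  proof
    fix i
    assume i: "i \<in> {i. (if i < 2 ^ n then a i else b (i - 2 ^ n)) \<noteq> 0}"
    show "i \<in> {..<2 ^ n} \<union> (\<lambda>i. i + 2 ^ n) ` {i. b i \<noteq> 0}"
    proof (cases "i < 2 ^ n")
      case False
      then have "i = (i - 2 ^ n) + 2 ^ n" and "b (i - 2 ^ n) \<noteq> 0" using i by auto
      then show ?thesis by blast
    qed simp
  qed
  ultimately show "finite {i. (if i < 2 ^ n then a i else b (i - 2 ^ n)) \<noteq> 0}"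
    by (rule finite_subset[rotated])
qed

lift_definition cd_fst :: "nat \<Rightarrow> cd \<Rightarrow> cd"
  is "\<lambda>n x i. if i < 2 ^ n then x i else 0"
  by simp

lift_definition cd_snd :: "nat \<Rightarrow> cd \<Rightarrow> cd"
  is "\<lambda>n x i. if i < 2 ^ n then x (i + 2 ^ n) else 0"
  by simp

primrec cd_conj :: "nat \<Rightarrow> cd \<Rightarrow> cd" where
  "cd_conj 0 x = x"
| "cd_conj (Suc n) x = cd_pair n (cd_conj n (cd_fst n x)) (- cd_snd n x)"

primrec cd_mult :: "nat \<Rightarrow> cd \<Rightarrow> cd \<Rightarrow> cd" where
  "cd_mult 0 x y = Poly_Mapping.single 0 (Poly_Mapping.lookup x 0 * Poly_Mapping.lookup y 0)"
| "cd_mult (Suc n) x y =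
    (let a = cd_fst n x; b = cd_snd n x; c = cd_fst n y; d = cd_snd n y in
      cd_pair n (cd_mult n a c - cd_mult n (cd_conj n d) b)
                (cd_mult n d a + cd_mult n b (cd_conj n c)))"

(* The unit is 1 in A_0 and (1, 0) in A_(n+1); under the above encoding it is the same sequence
   for every n. *)
definition cd_one :: cd where
  "cd_one = Poly_Mapping.single 0 1"

(* Only meaningful for n \<ge> 1. *)
definition cd_i :: "nat \<Rightarrow> cd" where
  "cd_i n = cd_pair (n - 1) 0 cd_one"

definition cd_Re :: "nat \<Rightarrow> cd \<Rightarrow> cd" where
  "cd_Re n x = (1 / 2) *\<^sub>R (x + cd_conj n x)"

(* cd_Re n x is a real multiple of the unit (see cd_Re_eq below), which is identified with a real
   number by taking its coordinate 0. *)
definition cd_inner :: "nat \<Rightarrow> cd \<Rightarrow> cd \<Rightarrow> real" where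
  "cd_inner n a b = Poly_Mapping.lookup (cd_Re n (cd_mult n a (cd_conj n b))) 0"

definition cd_C :: "nat \<Rightarrow> cd set" where
  "cd_C n = span {cd_one, cd_i n}"

definition cd_C_perp :: "nat \<Rightarrow> cd set" where
  "cd_C_perp n = {x \<in> cd_carrier n. \<forall>y \<in> cd_C n. cd_inner n x y = 0}"

definition cd_Ann :: "nat \<Rightarrow> cd \<Rightarrow> cd set" where
  "cd_Ann n x = {y \<in> cd_carrier n. cd_mult n x y = 0}"

(* The element {a, b} of A_(n+1), for a and b in A_n. *)
definition cd_brace :: "nat \<Rightarrow> cd \<Rightarrow> cd \<Rightarrow> cd" where
  "cd_brace n a b = (1 / sqrt 2) *\<^sub>R cd_pair n (a + b) (cd_mult n (cd_i n) (- a + b))"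

lemma lookup_scaleR_cd:
  fixes x :: cd
  shows "Poly_Mapping.lookup (r *\<^sub>R x) i = r * Poly_Mapping.lookup x i"
proof -
  have "finite {i. r * Poly_Mapping.lookup x i \<noteq> 0}"
    by (rule finite_subset[OF _ finite_keys[of x]]) (auto simp: in_keys_iff)
  then show ?thesis by (simp add: scaleR_poly_mapping_def)
qed

lemma cd_fst_in_carrier [simp]: "cd_fst n x \<in> cd_carrier n"
  by (simp add: cd_carrier_def cd_fst.rep_eq)

lemma cd_snd_in_carrier [simp]: "cd_snd n x \<in> cd_carrier n"
  by (simp add: cd_carrier_def cd_snd.rep_eq)

lemma cd_pair_in_carrier:
  assumes "b \<in> cd_carrier n"
  shows "cd_pair n a b \<in> cd_carrier (Suc n)"
  using assms by (auto simp: cd_carrier_def cd_pair.rep_eq)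

lemma cd_fst_pair:
  assumes "a \<in> cd_carrier n"
  shows "cd_fst n (cd_pair n a b) = a"
  using assms by (auto intro!: poly_mapping_eqI simp: cd_carrier_def cd_fst.rep_eq cd_pair.rep_eq)

lemma cd_snd_pair:
  assumes "b \<in> cd_carrier n"
  shows "cd_snd n (cd_pair n a b) = b"
  using assms by (auto intro!: poly_mapping_eqI simp: cd_carrier_def cd_snd.rep_eq cd_pair.rep_eq)

lemma cd_pair_fst_snd:
  assumes "x \<in> cd_carrier (Suc n)"
  shows "cd_pair n (cd_fst n x) (cd_snd n x) = x"
  using assms
  by (auto intro!: poly_mapping_eqI simp: cd_carrier_def cd_fst.rep_eq cd_snd.rep_eq cd_pair.rep_eq)

lemma cd_one_eq_pair: "cd_pair n cd_one 0 = cd_one"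
  by (rule poly_mapping_eqI) (simp add: cd_pair.rep_eq cd_one_def lookup_one when_def)

lemma cd_carrier_add: "x \<in> cd_carrier n \<Longrightarrow> y \<in> cd_carrier n \<Longrightarrow> x + y \<in> cd_carrier n"
  by (simp add: cd_carrier_def lookup_add)

lemma cd_carrier_diff: "x \<in> cd_carrier n \<Longrightarrow> y \<in> cd_carrier n \<Longrightarrow> x - y \<in> cd_carrier n"
  by (simp add: cd_carrier_def lookup_minus)

lemma cd_carrier_uminus: "x \<in> cd_carrier n \<Longrightarrow> - x \<in> cd_carrier n"
  by (simp add: cd_carrier_def)

lemma cd_conj_in_carrier: "x \<in> cd_carrier n \<Longrightarrow> cd_conj n x \<in> cd_carrier n"
  by (induction n arbitrary: x) (auto intro!: cd_pair_in_carrier cd_carrier_uminus)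

lemma cd_mult_in_carrier:
  "x \<in> cd_carrier n \<Longrightarrow> y \<in> cd_carrier n \<Longrightarrow> cd_mult n x y \<in> cd_carrier n"
proof (induction n arbitrary: x y)
  case 0
  then show ?case by (simp add: cd_carrier_def lookup_single when_def)
next
  case (Suc n)
  then show ?case
    by (simp add: Let_def cd_pair_in_carrier cd_carrier_add cd_conj_in_carrier)
qed

lemma lookup_cd_conj:
  assumes "x \<in> cd_carrier n"
  shows "Poly_Mapping.lookup (cd_conj n x) i =
    (if i = 0 then Poly_Mapping.lookup x 0 else - Poly_Mapping.lookup x i)"
  using assms
proof (induction n arbitrary: x i)
  case 0
  then show ?case by (simp add: cd_carrier_def)
next
  case (Suc n)
  have "Poly_Mapping.lookup x j = 0" if "j \<ge> 2 * 2 ^ n" for j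
    using Suc.prems that by (simp add: cd_carrier_def)
  then show ?case
    by (auto simp: Suc.IH cd_pair.rep_eq cd_fst.rep_eq cd_snd.rep_eq)
qed

lemma cd_Re_eq:
  assumes "x \<in> cd_carrier n"
  shows "cd_Re n x = Poly_Mapping.lookup x 0 *\<^sub>R cd_one"
  using assms
  by (intro poly_mapping_eqI)
     (simp add: cd_Re_def cd_one_def lookup_add lookup_cd_conj lookup_one lookup_scaleR_cd when_def)

lemma cd_brace_in_carrier:
  assumes "n \<ge> 1" and "a \<in> cd_carrier n" and "b \<in> cd_carrier n"
  shows "cd_brace n a b \<in> cd_carrier (Suc n)"
proof -
  obtain m where n: "n = Suc m" using assms(1) by (cases n) auto
  have "cd_i n \<in> cd_carrier n"
    unfolding cd_i_def n diff_Suc_1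
    by (rule cd_pair_in_carrier) (simp add: cd_carrier_def cd_one_def lookup_one when_def)
  then have "cd_pair n (a + b) (cd_mult n (cd_i n) (- a + b)) \<in> cd_carrier (Suc n)"
    by (intro cd_pair_in_carrier cd_mult_in_carrier cd_carrier_add cd_carrier_uminus assms)
  then show ?thesis
    by (simp add: cd_brace_def cd_carrier_def lookup_scaleR_cd)
qed

end

theory Submission
  imports Defs
begin

text \<open>For \<open>\<alpha>\<close> in \<open>\<complex>\<^sub>m\<^sup>\<bottom>\<close>, left multiplication by \<open>\<alpha>\<close> is skew-symmetric, so \<open>Ann(\<alpha>)\<close> is the radical of
  the alternating form \<open>\<langle>\<alpha> u, v\<rangle>\<close> on \<open>A\<^sub>m\<close>. It also anticommutes with left multiplication by \<open>i\<^sub>m\<close>, so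
  the form is the real part of an alternating complex-bilinear form; as these have even rank,
  \<open>dim Ann(\<alpha>)\<close> is divisible by 4 for \<open>m \<ge> 2\<close>.

  Now let \<open>\<alpha> = {a, b}\<close> and let \<open>P\<close> be the subspace of all \<open>{x, y}\<close> with \<open>x, y\<close> in \<open>\<complex>\<^sub>n\<^sup>\<bottom>\<close>, of codimension 4 in
  \<open>A\<^bsub>n+1\<^esub>\<close>. On \<open>P\<close> the form splits as \<open>\<surd>2 (\<langle>a x, z\<rangle> + \<langle>b y, w\<rangle>)\<close>, hence its radical there has dimension
  \<open>(dim Ann(a) + 2) + (dim Ann(b) + 2)\<close>. Passing between \<open>P\<close> and \<open>A\<^bsub>n+1\<^esub>\<close> changes the dimension of the
  radical by at most 4, and the increase 4 is impossible because \<open>{a, 0}\<close> lies in the radical on \<open>P\<close>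
  but does not annihilate. So \<open>dim Ann({a, b}) - dim Ann(a) - dim Ann(b)\<close> is a multiple of 4
  between 0 and 7.\<close>

subsection \<open>Dimensions, kernels and radicals\<close>

text \<open>Subtracting \<open>(f v / f z) *\<^sub>R z\<close> moves any \<open>v\<close> in
  \<open>S\<close> into the kernel, so \<open>z\<close> together with a basis of the kernel is a
  basis of \<open>S\<close>. The finite spanning set \<open>B\<close> keeps the cardinalities
  meaningful inside the infinite-dimensional ambient space of sequences.\<close>

lemma dim_linear_kernel:
  fixes S :: "'a::real_vector set" and f :: "'a \<Rightarrow> real"
  assumes "finite B" "S \<subseteq> span B" "subspace S" "linear f" "z \<in> S" "f z \<noteq> 0"
  shows "dim S = Suc (dim {v \<in> S. f v = 0})"
proof -
  let ?K = "{v \<in> S. f v = 0}"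
  have K: "subspace ?K"
    using assms(3,4) by (auto simp: subspace_def linear_add linear_scale linear_0)
  obtain C where C: "C \<subseteq> ?K" "independent C" "?K \<subseteq> span C" "card C = dim ?K"
    by (rule basis_exists)
  have "finite C"
    using independent_span_bound[OF assms(1) C(2)] C(1) assms(2) by blast
  have "z \<notin> span C"
    using span_minimal[OF C(1) K] assms(6) by blast
  then have z: "z \<notin> C" by (auto simp: span_base)
  have "S \<subseteq> span (insert z C)"
  proof
    fix v assume v: "v \<in> S"
    have "v - (f v / f z) *\<^sub>R z \<in> ?K"
      using assms(3-6) v by (simp add: linear_diff linear_scale subspace_diff subspace_scale)
    then have "v - (f v / f z) *\<^sub>R z \<in> span C" using C(3) by blast
    then show "v \<in> span (insert z C)" by (auto simp: span_insert)
  qed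
  then have "dim S = card (insert z C)"
    using C(1,2) \<open>z \<notin> span C\<close> assms(5) by (intro dim_unique[of "insert z C"]) (auto simp: independent_insertI)
  then show ?thesis using z \<open>finite C\<close> C(4) by simp
qed

lemma dim_le_Suc_dim_kernel:
  fixes S :: "'a::real_vector set" and f :: "'a \<Rightarrow> real"
  assumes "finite B" "S \<subseteq> span B" "subspace S" "linear f"
  shows "dim S \<le> Suc (dim {v \<in> S. f v = 0})"
proof (cases "\<exists>z\<in>S. f z \<noteq> 0")
  case True
  then show ?thesis using dim_linear_kernel[OF assms] by force
next
  case False
  then have "{v \<in> S. f v = 0} = S" by auto
  then show ?thesis by simp
qed

text \<open>Each functional lowers the dimension by at most one. This bounds the change of a radical
  when finitely many coordinate conditions are imposed.\<close>

lemma dim_le_dim_kernel_add_card: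
  fixes S :: "'a::real_vector set" and f :: "'i \<Rightarrow> 'a \<Rightarrow> real"
  assumes "finite B" "S \<subseteq> span B" "subspace S" "finite I" "\<And>i. i \<in> I \<Longrightarrow> linear (f i)"
  shows "dim S \<le> dim {v \<in> S. \<forall>i\<in>I. f i v = 0} + card I"
  using assms(4,5)
proof (induction I rule: finite_induct)
  case (insert i I)
  let ?K = "{v \<in> S. \<forall>i\<in>I. f i v = 0}"
  have "subspace ?K"
    using assms(3) insert.prems by (auto simp: subspace_def linear_add linear_scale linear_0)
  then have "dim ?K \<le> Suc (dim {v \<in> ?K. f i v = 0})"
    using assms(2) insert.prems by (intro dim_le_Suc_dim_kernel[OF assms(1)]) auto
  moreover have "{v \<in> ?K. f i v = 0} = {v \<in> S. \<forall>i\<in>insert i I. f i v = 0}" by auto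
  ultimately show ?case using insert by simp
qed simp

lemma dim_subspace_mono:
  fixes S T :: "'a::real_vector set"
  assumes "finite B" "T \<subseteq> span B" "S \<subseteq> T"
  shows "dim S \<le> dim T"
proof -
  obtain C where C: "C \<subseteq> T" "independent C" "T \<subseteq> span C" "card C = dim T"
    by (rule basis_exists)
  have "finite C"
    using independent_span_bound[OF assms(1) C(2)] C(1) assms(2) by blast
  then show ?thesis using dim_le_card[of S C] C assms(3) by auto
qed

text \<open>A vanishing combination of a basis of \<open>S\<close> and a basis of \<open>T\<close>
  splits into an element of \<open>S\<close> and its negative in \<open>T\<close>; both lie in the
  trivial intersection, so the two bases are jointly independent.\<close>

lemma dim_direct_sum:
  fixes S T :: "'a::real_vector set"
  assumes "finite B" "S \<subseteq> span B" "T \<subseteq> span B" "subspace S" "subspace T" "S \<inter> T \<subseteq> {0}"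
  shows "dim {x + y |x y. x \<in> S \<and> y \<in> T} = dim S + dim T"
proof -
  obtain C where C: "C \<subseteq> S" "independent C" "S \<subseteq> span C" "card C = dim S"
    by (rule basis_exists)
  obtain D where D: "D \<subseteq> T" "independent D" "T \<subseteq> span D" "card D = dim T"
    by (rule basis_exists)
  have fin: "finite C" "finite D"
    using independent_span_bound[OF assms(1) C(2)] independent_span_bound[OF assms(1) D(2)]
      C(1) D(1) assms(2,3) by blast+
  have CS: "span C = S" and DT: "span D = T"
    using C D assms(4,5) by (auto intro: span_minimal[THEN subsetD])
  have "0 \<notin> C" using C(2) dependent_zero by blast
  then have disj: "C \<inter> D = {}" using C(1) D(1) assms(6) by blast
  have "independent (C \<union> D)"
  proof (rule independent_if_scalars_zero)
    fix f x assume s: "(\<Sum>x\<in>C \<union> D. f x *\<^sub>R x) = 0" and x: "x \<in> C \<union> D"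
    have e: "(\<Sum>x\<in>C. f x *\<^sub>R x) = - (\<Sum>x\<in>D. f x *\<^sub>R x)"
      using s fin disj by (simp add: sum.union_disjoint eq_neg_iff_add_eq_0)
    have "(\<Sum>x\<in>C. f x *\<^sub>R x) \<in> S" "(\<Sum>x\<in>D. f x *\<^sub>R x) \<in> T"
      unfolding CS[symmetric] DT[symmetric] by (intro span_sum span_scale span_base; assumption)+
    then have "(\<Sum>x\<in>C. f x *\<^sub>R x) = 0"
      using e assms(5,6) subspace_neg by (metis Int_iff singletonD subsetD)
    moreover from this have "(\<Sum>x\<in>D. f x *\<^sub>R x) = 0" using e by simp
    ultimately show "f x = 0"
      using x C(2) D(2) fin by (auto simp: dependent_finite)
  qed (use fin in simp)
  moreover have "{x + y |x y. x \<in> S \<and> y \<in> T} = span (C \<union> D)"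
    unfolding span_Un CS DT ..
  ultimately have "dim {x + y |x y. x \<in> S \<and> y \<in> T} = card (C \<union> D)"
    by (simp add: dim_eq_card_independent)
  then show ?thesis using fin disj C(4) D(4) by (simp add: card_Un_disjoint)
qed

lemma dim_injective_image:
  fixes f :: "'a::real_vector \<Rightarrow> 'b::real_vector"
  assumes "linear f" "subspace S" "inj_on f S"
  shows "dim (f ` S) = dim S"
proof -
  obtain C where C: "C \<subseteq> S" "independent C" "S \<subseteq> span C" "card C = dim S"
    by (rule basis_exists)
  have CS: "span C = S"
    using C assms(2) by (auto intro: span_minimal[THEN subsetD])
  have "independent (f ` C)"
    using assms C CS by (intro linear_independent_injective_image) auto
  moreover have "f ` S = span (f ` C)" using linear_span_image[OF assms(1)] CS by metis
  ultimately have "dim (f ` S) = card (f ` C)"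
    by (simp add: dim_eq_card_independent)
  then show ?thesis
    using C(1,4) assms(3) by (metis card_image inj_on_subset)
qed

text \<open>Symplectic reduction: the hypotheses make \<open>\<omega>(x, y) - i \<omega>(J x, y)\<close> an alternating
  complex-bilinear form for the complex structure \<open>J\<close>, whose complex rank is even.\<close>

lemma dim_minus_dim_radical_dvd_4:
  fixes V :: "'a::real_vector set" and \<omega> :: "'a \<Rightarrow> 'a \<Rightarrow> real"
  assumes B: "finite B" and VB: "V \<subseteq> span B" and V: "subspace V"
    and lin: "\<And>y. linear (\<lambda>x. \<omega> x y)"
    and lin': "\<And>x. linear (\<omega> x)"
    and skew: "\<And>x y. x \<in> V \<Longrightarrow> y \<in> V \<Longrightarrow> \<omega> y x = - \<omega> x y"
    and J: "\<And>x. x \<in> V \<Longrightarrow> J x \<in> V"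
    and JJ: "\<And>x. x \<in> V \<Longrightarrow> J (J x) = - x"
    and omJ: "\<And>x y. x \<in> V \<Longrightarrow> y \<in> V \<Longrightarrow> \<omega> (J x) y = \<omega> x (J y)"
  shows "\<exists>k. dim V = dim {x \<in> V. \<forall>y\<in>V. \<omega> x y = 0} + 4 * k"
  using VB V skew J JJ omJ
proof (induction "dim V" arbitrary: V rule: less_induct)
  \<comment> \<open>While the form is non-zero on \<open>V\<close>, a non-degenerate
    \<open>J\<close>-stable 4-dimensional subspace spanned by \<open>x\<close>, \<open>J x\<close>,
    \<open>y\<close>, \<open>J y\<close> is split off, and the induction continues on its orthogonal
    complement \<open>V4\<close>.\<close>
  case less
  note VB = less.prems(1) and V = less.prems(2) and skew = less.prems(3)
    and J = less.prems(4) and JJ = less.prems(5) and omJ = less.prems(6)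
  show ?case
  proof (cases "\<forall>x\<in>V. \<forall>y\<in>V. \<omega> x y = 0")
    case True
    then have "{x \<in> V. \<forall>y\<in>V. \<omega> x y = 0} = V" by auto
    then show ?thesis by (intro exI[of _ 0]) simp
  next
    case False
    then obtain x y0 where x: "x \<in> V" and y0: "y0 \<in> V" and nz: "\<omega> x y0 \<noteq> 0" by auto
    have radd: "\<omega> u (v + w) = \<omega> u v + \<omega> u w" for u v w
      by (rule linear_add[OF lin'])
    have rscale: "\<omega> u (r *\<^sub>R v) = r * \<omega> u v" for u v r
      using linear_scale[OF lin'] by simp
    have neg: "\<omega> u (- v) = - \<omega> u v" for u v
      by (rule linear_neg[OF lin'])
    \<comment> \<open>In complex terms, \<open>y\<close> is \<open>y0\<close> multiplied by the
      conjugate of the complex value of the form at \<open>(x, y0)\<close>. The new value at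
      \<open>(x, y)\<close> is therefore real and non-zero, which is what \<open>xy\<close> and
      \<open>xJy\<close> say.\<close>
    define y where "y = \<omega> x y0 *\<^sub>R y0 + \<omega> x (J y0) *\<^sub>R J y0"
    have y: "y \<in> V" unfolding y_def by (intro subspace_add subspace_scale V y0 J)
    have "\<omega> x y = (\<omega> x y0)\<^sup>2 + (\<omega> x (J y0))\<^sup>2"
      unfolding y_def by (simp add: radd rscale power2_eq_square)
    then have xy: "\<omega> x y \<noteq> 0" using nz by (simp add: sum_power2_eq_zero_iff)
    have xJy: "\<omega> x (J y) = 0"
    proof -
      have "\<omega> x (J y) = \<omega> (J x) y" by (rule omJ[OF x y, symmetric])
      also have "\<dots> = \<omega> x y0 * \<omega> (J x) y0 + \<omega> x (J y0) * \<omega> (J x) (J y0)"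
        unfolding y_def by (simp add: radd rscale)
      also have "\<omega> (J x) y0 = \<omega> x (J y0)" by (rule omJ[OF x y0])
      also have "\<omega> (J x) (J y0) = - \<omega> x y0" using omJ[OF x J[OF y0]] by (simp add: JJ y0 neg)
      finally show ?thesis by simp
    qed
    have self: "\<omega> u (J u) = 0" if "u \<in> V" for u
      using skew[OF that J[OF that]] omJ[OF that that] by simp
    have zero: "\<omega> u u = 0" if "u \<in> V" for u
      using skew[OF that that] by simp
    have Jxy: "\<omega> (J x) y = 0" using omJ[OF x y] xJy by simp
    have JxJy: "\<omega> (J x) (J y) = - \<omega> x y" using omJ[OF x J[OF y]] by (simp add: JJ y neg)
    \<comment> \<open>The four orthogonality conditions are imposed one at a time. The vectors
      \<open>y\<close>, \<open>J y\<close>, \<open>x\<close>, \<open>J x\<close>, in this order,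
      satisfy all earlier conditions and violate the current one, so each step loses exactly one
      dimension.\<close>
    define V1 where "V1 = {v \<in> V. \<omega> v x = 0}"
    define V2 where "V2 = {v \<in> V1. \<omega> v (J x) = 0}"
    define V3 where "V3 = {v \<in> V2. \<omega> v y = 0}"
    define V4 where "V4 = {v \<in> V3. \<omega> v (J y) = 0}"
    have sub: "subspace {v \<in> U. \<omega> v u = 0}" if "subspace U" for U u
      using that by (auto simp: subspace_def linear_add[OF lin] linear_scale[OF lin] linear_0[OF lin])
    have s1: "subspace V1" unfolding V1_def by (rule sub[OF V])
    have s2: "subspace V2" unfolding V2_def by (rule sub[OF s1])
    have s3: "subspace V3" unfolding V3_def by (rule sub[OF s2])
    have s4: "subspace V4" unfolding V4_def by (rule sub[OF s3])
    have sB: "V1 \<subseteq> span B" "V2 \<subseteq> span B" "V3 \<subseteq> span B" "V4 \<subseteq> span B"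
      using VB unfolding V4_def V3_def V2_def V1_def by auto
    have "dim V = Suc (dim V1)"
      unfolding V1_def using y xy skew[OF x y] by (intro dim_linear_kernel[OF B VB V lin]) auto
    moreover have "dim V1 = Suc (dim V2)"
      unfolding V2_def
    proof (rule dim_linear_kernel[OF B sB(1) s1 lin, of "J y"])
      show "J y \<in> V1" using J[OF y] skew[OF x J[OF y]] xJy by (simp add: V1_def)
      show "\<omega> (J y) (J x) \<noteq> 0" using skew[OF J[OF x] J[OF y]] JxJy xy by simp
    qed
    moreover have "dim V2 = Suc (dim V3)"
      unfolding V3_def
    proof (rule dim_linear_kernel[OF B sB(2) s2 lin _ xy])
      show "x \<in> V2" using x zero[OF x] self[OF x] by (simp add: V1_def V2_def)
    qed
    moreover have "dim V3 = Suc (dim V4)"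
      unfolding V4_def
    proof (rule dim_linear_kernel[OF B sB(3) s3 lin, of "J x"])
      show "J x \<in> V3"
        using J[OF x] skew[OF x J[OF x]] zero[OF J[OF x]] self[OF x] Jxy
        by (simp add: V1_def V2_def V3_def)
      show "\<omega> (J x) (J y) \<noteq> 0" using JxJy xy by simp
    qed
    ultimately have dimV: "dim V = dim V4 + 4" by simp
    have V4: "V4 = {v \<in> V. \<omega> v x = 0 \<and> \<omega> v (J x) = 0 \<and> \<omega> v y = 0 \<and> \<omega> v (J y) = 0}"
      unfolding V4_def V3_def V2_def V1_def by auto
    have "\<exists>k. dim V4 = dim {x \<in> V4. \<forall>y\<in>V4. \<omega> x y = 0} + 4 * k"
    proof (rule less.hyps[OF _ sB(4) s4])
      fix v assume "v \<in> V4"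
      then show "J v \<in> V4"
        unfolding V4 using J x y omJ[of v] JJ neg by auto
    next
      fix u v assume uv: "u \<in> V4" "v \<in> V4"
      show "\<omega> v u = - \<omega> u v" by (rule skew) (use uv V4 in auto)
      show "\<omega> (J u) v = \<omega> u (J v)" by (rule omJ) (use uv V4 in auto)
    qed (use dimV JJ V4 in auto)
    moreover have "{x \<in> V4. \<forall>y\<in>V4. \<omega> x y = 0} = {x \<in> V. \<forall>y\<in>V. \<omega> x y = 0}"
    proof (intro set_eqI iffI)
      fix u assume u: "u \<in> {x \<in> V4. \<forall>y\<in>V4. \<omega> x y = 0}"
      have "\<omega> u w = 0" if w: "w \<in> V" for w
      proof -
        define c where "c = \<omega> x y"
        have lc: "\<omega> (p + r *\<^sub>R q) z = \<omega> p z + r * \<omega> q z" for p q r z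
          by (simp add: linear_add[OF lin] linear_scale[OF lin])
        have ld: "\<omega> (p - q) z = \<omega> p z - \<omega> q z" "\<omega> (r *\<^sub>R q) z = r * \<omega> q z" for p q r z
          by (simp_all add: linear_diff[OF lin] linear_scale[OF lin])
        \<comment> \<open>This is the projection of \<open>w\<close> to the complement of the four
          vectors. Its coefficients come from the Gram matrix \<open>vals\<close>, in which, up to
          symmetry, only the pairs \<open>(x, y)\<close> and \<open>(J x, J y)\<close> have non-zero
          values, \<open>c\<close> and \<open>- c\<close>. Since \<open>u\<close> in
          \<open>V4\<close> is orthogonal to the correction terms, \<open>w\<close> and
          \<open>w'\<close> pair equally with \<open>u\<close>.\<close>
        define w' where "w' = w + (\<omega> w x / c) *\<^sub>R y + (- \<omega> w (J x) / c) *\<^sub>R J y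
          + (- \<omega> w y / c) *\<^sub>R x + (\<omega> w (J y) / c) *\<^sub>R J x"
        have c: "c \<noteq> 0" using xy by (simp add: c_def)
        have vals: "\<omega> x x = 0" "\<omega> x (J x) = 0" "\<omega> x y = c" "\<omega> x (J y) = 0"
          "\<omega> (J x) x = 0" "\<omega> (J x) (J x) = 0" "\<omega> (J x) y = 0" "\<omega> (J x) (J y) = - c"
          "\<omega> y x = - c" "\<omega> y (J x) = 0" "\<omega> y y = 0" "\<omega> y (J y) = 0"
          "\<omega> (J y) x = 0" "\<omega> (J y) (J x) = c" "\<omega> (J y) y = 0" "\<omega> (J y) (J y) = 0"
          using zero[OF x] zero[OF y] self[OF x] self[OF y] xJy Jxy JxJy
            zero[OF J[OF x]] zero[OF J[OF y]] skew[OF x J[OF x]] skew[OF y J[OF y]]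
            skew[OF x y] skew[OF J[OF x] y] skew[OF x J[OF y]] skew[OF J[OF x] J[OF y]]
          by (simp_all add: c_def)
        have w': "w' \<in> V"
          unfolding w'_def by (intro subspace_add subspace_scale V J x y w)
        have "w' \<in> V4"
          unfolding V4 using w' c by (simp add: w'_def lc ld vals)
        then have "\<omega> u w' = 0" using u by blast
        moreover have "\<omega> u x = 0" "\<omega> u (J x) = 0" "\<omega> u y = 0" "\<omega> u (J y) = 0" "u \<in> V"
          using u by (auto simp: V4)
        ultimately show ?thesis
          unfolding w'_def
          by (simp add: radd rscale linear_diff[OF lin'])
      qed
      then show "u \<in> {x \<in> V. \<forall>y\<in>V. \<omega> x y = 0}" using u by (auto simp: V4)
    next
      fix u assume "u \<in> {x \<in> V. \<forall>y\<in>V. \<omega> x y = 0}"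
      then show "u \<in> {x \<in> V4. \<forall>y\<in>V4. \<omega> x y = 0}" using x y J by (auto simp: V4)
    qed
    ultimately obtain k where "dim V4 = dim {x \<in> V. \<forall>y\<in>V. \<omega> x y = 0} + 4 * k" by auto
    then show ?thesis using dimV by (intro exI[of _ "Suc k"]) simp
  qed
qed

subsection \<open>Cayley-Dickson arithmetic\<close>

abbreviation coord :: "cd \<Rightarrow> nat \<Rightarrow> real" where
  "coord \<equiv> Poly_Mapping.lookup"

abbreviation cd_unit :: "nat \<Rightarrow> cd" where
  "cd_unit j \<equiv> Poly_Mapping.single j 1"

text \<open>The Euclidean inner product in coordinates. It agrees with \<open>cd_inner\<close> on
  \<open>cd_carrier n\<close> by \<open>cd_inner_eq_dot\<close>, and its symmetry and bilinearity
  are visible without unfolding products.\<close>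

definition cd_dot :: "nat \<Rightarrow> cd \<Rightarrow> cd \<Rightarrow> real" where
  "cd_dot n x y = (\<Sum>i<2 ^ n. coord x i * coord y i)"

declare cd_mult.simps(2) [simp del] cd_conj.simps(2) [simp del]

section \<open>Linearity of the operations\<close>

lemma linear_coord: "linear (\<lambda>x. coord x i)"
  by (rule linearI) (simp_all add: lookup_add lookup_scaleR_cd)

lemma linear_cd_fst: "linear (cd_fst n)"
  by (rule linearI) (auto intro!: poly_mapping_eqI simp: cd_fst.rep_eq lookup_add lookup_scaleR_cd)

lemma linear_cd_snd: "linear (cd_snd n)"
  by (rule linearI) (auto intro!: poly_mapping_eqI simp: cd_snd.rep_eq lookup_add lookup_scaleR_cd)

lemma cd_pair_add: "cd_pair n a b + cd_pair n c d = cd_pair n (a + c) (b + d)"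
  by (rule poly_mapping_eqI) (simp add: cd_pair.rep_eq lookup_add)

lemma cd_pair_scaleR: "r *\<^sub>R cd_pair n a b = cd_pair n (r *\<^sub>R a) (r *\<^sub>R b)"
  by (rule poly_mapping_eqI) (simp add: cd_pair.rep_eq lookup_scaleR_cd)

lemma cd_pair_uminus: "- cd_pair n a b = cd_pair n (- a) (- b)"
  by (rule poly_mapping_eqI) (simp add: cd_pair.rep_eq)

lemma cd_pair_0: "cd_pair n 0 0 = 0"
  by (rule poly_mapping_eqI) (simp add: cd_pair.rep_eq)

lemma linear_cd_conj: "linear (cd_conj n)"
proof (induction n)
  case 0
  show ?case by (rule linearI) simp_all
next
  case (Suc n)
  show ?case
    by (rule linearI)
      (simp_all add: cd_conj.simps(2) linear_add[OF Suc.IH] linear_add[OF linear_cd_fst] linear_add[OF linear_cd_snd]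
        linear_scale[OF Suc.IH] linear_scale[OF linear_cd_fst] linear_scale[OF linear_cd_snd]
        cd_pair_add cd_pair_scaleR)
qed

lemma linear_cd_mult: "linear (cd_mult n x)" "linear (\<lambda>x. cd_mult n x y)"
proof -
  \<comment> \<open>Both slots share one induction: in the pair formula the components of
    \<open>x\<close> and of \<open>y\<close> each occur as left and as right factors.\<close>
  have "linear (cd_mult n x) \<and> linear (\<lambda>x. cd_mult n x y)" for x y
  proof (induction n arbitrary: x y)
    case 0
    show ?case
      by (intro conjI linearI poly_mapping_eqI)
        (simp_all add: lookup_add lookup_single lookup_scaleR_cd when_def algebra_simps)
  next
    case (Suc n)
    note l = Suc.IH[THEN conjunct1] and r = Suc.IH[THEN conjunct2]
    note lins = linear_cd_fst linear_cd_snd linear_cd_conj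
    show ?case
      by (intro conjI linearI)
        (simp_all add: cd_mult.simps(2) Let_def lins[THEN linear_add] lins[THEN linear_scale]
          linear_add[OF l] linear_scale[OF l] linear_add[OF r] linear_scale[OF r]
          cd_pair_add cd_pair_scaleR algebra_simps)
  qed
  then show "linear (cd_mult n x)" "linear (\<lambda>x. cd_mult n x y)" by blast+
qed

lemma linear_cd_dot: "linear (cd_dot n x)" "linear (\<lambda>x. cd_dot n x y)"
  unfolding cd_dot_def
  by (rule linearI; simp add: lookup_add lookup_scaleR_cd algebra_simps sum.distrib sum_distrib_left)+

lemmas cd_conj_simps =
  linear_add[OF linear_cd_conj] linear_diff[OF linear_cd_conj] linear_scale[OF linear_cd_conj]
  linear_neg[OF linear_cd_conj] linear_0[OF linear_cd_conj]

lemmas cd_mult_simps =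
  linear_cd_mult(1)[THEN linear_add] linear_cd_mult(2)[THEN linear_add]
  linear_cd_mult(1)[THEN linear_diff] linear_cd_mult(2)[THEN linear_diff]
  linear_cd_mult(1)[THEN linear_scale] linear_cd_mult(2)[THEN linear_scale]
  linear_cd_mult(1)[THEN linear_neg] linear_cd_mult(2)[THEN linear_neg]
  linear_cd_mult(1)[THEN linear_0] linear_cd_mult(2)[THEN linear_0]

lemmas cd_dot_simps =
  linear_cd_dot(1)[THEN linear_add] linear_cd_dot(2)[THEN linear_add]
  linear_cd_dot(1)[THEN linear_diff] linear_cd_dot(2)[THEN linear_diff]
  linear_cd_dot(1)[THEN linear_scale] linear_cd_dot(2)[THEN linear_scale]
  linear_cd_dot(1)[THEN linear_neg] linear_cd_dot(2)[THEN linear_neg]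
  linear_cd_dot(1)[THEN linear_0] linear_cd_dot(2)[THEN linear_0]

lemma cd_dot_commute: "cd_dot n x y = cd_dot n y x"
  by (simp add: cd_dot_def mult.commute)

lemma subspace_cd_carrier: "subspace (cd_carrier n)"
  by (auto simp: subspace_def cd_carrier_def lookup_add lookup_scaleR_cd)

lemma cd_one_in_carrier: "cd_one \<in> cd_carrier n"
  by (simp add: cd_carrier_def cd_one_def lookup_one when_def)

lemmas cd_closed = cd_carrier_add cd_carrier_diff cd_carrier_uminus cd_conj_in_carrier
  cd_mult_in_carrier cd_one_in_carrier cd_pair_in_carrier subspace_0[OF subspace_cd_carrier]
  subspace_scale[OF subspace_cd_carrier]

section \<open>Conjugation, multiplication and the inner product on pairs\<close>

lemma cd_carrier_SucE:
  assumes "x \<in> cd_carrier (Suc n)"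
  obtains a b where "a \<in> cd_carrier n" "b \<in> cd_carrier n" "x = cd_pair n a b"
  using cd_pair_fst_snd[OF assms] by (metis cd_fst_in_carrier cd_snd_in_carrier)

lemma cd_mult_pair:
  assumes "a \<in> cd_carrier n" "b \<in> cd_carrier n" "c \<in> cd_carrier n" "d \<in> cd_carrier n"
  shows "cd_mult (Suc n) (cd_pair n a b) (cd_pair n c d) =
    cd_pair n (cd_mult n a c - cd_mult n (cd_conj n d) b) (cd_mult n d a + cd_mult n b (cd_conj n c))"
  using assms by (simp add: cd_mult.simps(2) cd_fst_pair cd_snd_pair)

lemma cd_conj_pair:
  assumes "a \<in> cd_carrier n" "b \<in> cd_carrier n"
  shows "cd_conj (Suc n) (cd_pair n a b) = cd_pair n (cd_conj n a) (- b)"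
  using assms by (simp add: cd_conj.simps(2) cd_fst_pair cd_snd_pair)

lemma cd_dot_pair:
  "cd_dot (Suc n) (cd_pair n a b) (cd_pair n c d) = cd_dot n a c + cd_dot n b d"
proof -
  let ?f = "\<lambda>i. coord (cd_pair n a b) i * coord (cd_pair n c d) i"
  have "cd_dot (Suc n) (cd_pair n a b) (cd_pair n c d) = sum ?f {0..<2 ^ n + 2 ^ n}"
    by (simp add: cd_dot_def lessThan_atLeast0 mult_2)
  also have "\<dots> = sum ?f {0..<2 ^ n} + sum ?f {0 + 2 ^ n..<2 ^ n + 2 ^ n}"
    by (simp add: sum.atLeastLessThan_concat)
  also have "\<dots> = cd_dot n a c + cd_dot n b d"
    unfolding sum.shift_bounds_nat_ivl by (simp add: cd_dot_def lessThan_atLeast0 cd_pair.rep_eq)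
  finally show ?thesis .
qed

lemma cd_conj_conj: "x \<in> cd_carrier n \<Longrightarrow> cd_conj n (cd_conj n x) = x"
  by (rule poly_mapping_eqI) (simp add: lookup_cd_conj cd_closed)

lemma cd_conj_one: "cd_conj n cd_one = cd_one"
  by (rule poly_mapping_eqI)
    (simp add: lookup_cd_conj cd_one_in_carrier, simp add: cd_one_def lookup_one when_def)

lemma cd_conj_imaginary: "x \<in> cd_carrier n \<Longrightarrow> coord x 0 = 0 \<Longrightarrow> cd_conj n x = - x"
  by (rule poly_mapping_eqI) (simp add: lookup_cd_conj)

lemma cd_mult_conj:
  assumes "x \<in> cd_carrier n" "y \<in> cd_carrier n"
  shows "cd_conj n (cd_mult n x y) = cd_mult n (cd_conj n y) (cd_conj n x)"
  using assms
proof (induction n arbitrary: x y)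
  case 0
  then show ?case by (simp add: mult.commute)
next
  case (Suc n)
  from Suc.prems obtain a b c d where "x = cd_pair n a b" "y = cd_pair n c d"
    "a \<in> cd_carrier n" "b \<in> cd_carrier n" "c \<in> cd_carrier n" "d \<in> cd_carrier n"
    by (elim cd_carrier_SucE)
  then show ?case
    by (simp add: cd_mult_pair cd_conj_pair cd_closed cd_conj_simps cd_mult_simps Suc.IH cd_conj_conj
        minus_diff_commute)
qed

lemma cd_mult_one: "x \<in> cd_carrier n \<Longrightarrow> cd_mult n cd_one x = x \<and> cd_mult n x cd_one = x"
proof (induction n arbitrary: x)
  case 0
  then show ?case
    by (auto intro!: poly_mapping_eqI simp: cd_one_def lookup_single lookup_one when_def cd_carrier_def)
next
  case (Suc n)
  from Suc.prems obtain a b where x: "x = cd_pair n a b" "a \<in> cd_carrier n" "b \<in> cd_carrier n"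
    by (elim cd_carrier_SucE)
  have "cd_mult (Suc n) (cd_pair n cd_one 0) x = x \<and> cd_mult (Suc n) x (cd_pair n cd_one 0) = x"
    by (simp add: cd_mult_pair cd_closed x cd_mult_simps cd_conj_simps Suc.IH cd_conj_one)
  then show ?case unfolding cd_one_eq_pair .
qed

lemma cd_dot_conj:
  assumes "x \<in> cd_carrier n" "y \<in> cd_carrier n"
  shows "cd_dot n (cd_conj n x) (cd_conj n y) = cd_dot n x y"
  using assms by (auto simp: cd_dot_def lookup_cd_conj intro!: sum.cong)

text \<open>The pair formula multiplies components from both sides, so the induction step also needs
  the adjoint of right multiplication. That version, \<open>right\<close>, follows from the
  induction hypothesis because conjugation is an isometry reversing products.\<close>

lemma cd_dot_adjoint:
  assumes "a \<in> cd_carrier n" "x \<in> cd_carrier n" "y \<in> cd_carrier n"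
  shows "cd_dot n (cd_mult n a x) y = cd_dot n x (cd_mult n (cd_conj n a) y)"
  using assms
proof (induction n arbitrary: a x y)
  case 0
  then show ?case by (simp add: cd_dot_def)
next
  case (Suc n)
  have right: "cd_dot n (cd_mult n x a) y = cd_dot n x (cd_mult n y (cd_conj n a))"
    if "a \<in> cd_carrier n" "x \<in> cd_carrier n" "y \<in> cd_carrier n" for a x y
  proof -
    have "cd_dot n (cd_mult n x a) y = cd_dot n (cd_mult n (cd_conj n a) (cd_conj n x)) (cd_conj n y)"
      using that by (subst cd_dot_conj[symmetric]) (simp_all add: cd_closed cd_mult_conj)
    also have "\<dots> = cd_dot n (cd_conj n x) (cd_mult n a (cd_conj n y))"
      using that by (simp add: Suc.IH cd_closed cd_conj_conj)
    also have "\<dots> = cd_dot n x (cd_mult n y (cd_conj n a))"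
      using that by (subst cd_dot_conj[symmetric]) (simp_all add: cd_closed cd_mult_conj cd_conj_conj)
    finally show ?thesis .
  qed
  from Suc.prems obtain p q c d e f where
    eq: "a = cd_pair n p q" "x = cd_pair n c d" "y = cd_pair n e f" and
    mem: "p \<in> cd_carrier n" "q \<in> cd_carrier n" "c \<in> cd_carrier n" "d \<in> cd_carrier n"
    "e \<in> cd_carrier n" "f \<in> cd_carrier n"
    by (elim cd_carrier_SucE)
  \<comment> \<open>The facts 1 to 4 match the four terms in the expansion of the left-hand side
    with the four terms of the right-hand side.\<close>
  have 1: "cd_dot n (cd_mult n p c) e = cd_dot n c (cd_mult n (cd_conj n p) e)"
    by (rule Suc.IH; simp add: mem)
  have 2: "cd_dot n (cd_mult n d p) f = cd_dot n d (cd_mult n f (cd_conj n p))"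
    by (rule right; simp add: mem)
  have 3: "cd_dot n (cd_mult n q (cd_conj n c)) f = cd_dot n c (cd_mult n (cd_conj n f) q)"
  proof -
    have "cd_dot n (cd_mult n q (cd_conj n c)) f = cd_dot n (cd_conj n c) (cd_mult n (cd_conj n q) f)"
      by (rule Suc.IH; simp add: mem cd_closed)
    also have "\<dots> = cd_dot n c (cd_mult n (cd_conj n f) q)"
      using mem by (subst cd_dot_conj[symmetric]) (simp_all add: cd_closed cd_mult_conj cd_conj_conj)
    finally show ?thesis .
  qed
  have 4: "cd_dot n (cd_mult n (cd_conj n d) q) e = cd_dot n d (cd_mult n q (cd_conj n e))"
  proof -
    have "cd_dot n (cd_mult n (cd_conj n d) q) e = cd_dot n (cd_conj n d) (cd_mult n e (cd_conj n q))"
      by (rule right; simp add: mem cd_closed)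
    also have "\<dots> = cd_dot n d (cd_mult n q (cd_conj n e))"
      using mem by (subst cd_dot_conj[symmetric]) (simp_all add: cd_closed cd_mult_conj cd_conj_conj)
    finally show ?thesis .
  qed
  show ?case
    by (simp add: eq mem cd_mult_pair cd_conj_pair cd_dot_pair cd_closed cd_conj_simps cd_mult_simps
        cd_dot_simps 1 2 3 4)
qed

text \<open>The adjoint of left multiplication by \<open>a\<close> is left multiplication by the
  conjugate, here \<open>- a\<close>. This skewness makes \<open><a x, y>\<close> an alternating
  form.\<close>

lemma cd_dot_imaginary:
  assumes "a \<in> cd_carrier n" "coord a 0 = 0" "x \<in> cd_carrier n" "y \<in> cd_carrier n"
  shows "cd_dot n (cd_mult n a x) y = - cd_dot n x (cd_mult n a y)"
  using cd_dot_adjoint[OF assms(1,3,4)] cd_conj_imaginary[OF assms(1,2)]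
  by (simp add: cd_mult_simps cd_dot_simps)

text \<open>Applied to the conjugate of \<open>y\<close>, this identifies the real part defining
  \<open>cd_inner\<close> with the coordinate dot product.\<close>

lemma coord_0_cd_mult:
  assumes "x \<in> cd_carrier n" "y \<in> cd_carrier n"
  shows "coord (cd_mult n x y) 0 = cd_dot n x (cd_conj n y)"
  using assms
proof (induction n arbitrary: x y)
  case 0
  then show ?case by (simp add: cd_dot_def)
next
  case (Suc n)
  from Suc.prems obtain a b c d where eq: "x = cd_pair n a b" "y = cd_pair n c d" and
    mem: "a \<in> cd_carrier n" "b \<in> cd_carrier n" "c \<in> cd_carrier n" "d \<in> cd_carrier n"
    by (elim cd_carrier_SucE)
  have "cd_dot n (cd_conj n d) (cd_conj n b) = cd_dot n b d"
    using mem by (simp add: cd_dot_conj cd_dot_commute)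
  then show ?case
    using mem
    by (simp add: eq cd_mult_pair cd_conj_pair cd_dot_pair cd_closed cd_dot_simps cd_pair.rep_eq
        lookup_minus Suc.IH)
qed

lemma cd_inner_eq_dot:
  assumes "x \<in> cd_carrier n" "y \<in> cd_carrier n"
  shows "cd_inner n x y = cd_dot n x y"
  using assms
  by (simp add: cd_inner_def cd_Re_eq cd_closed lookup_scaleR_cd cd_one_def coord_0_cd_mult cd_conj_conj)

section \<open>Standard basis and dimension of A_n\<close>

lemma cd_dot_unit: "j < 2 ^ n \<Longrightarrow> cd_dot n x (cd_unit j) = coord x j"
  by (simp add: cd_dot_def lookup_single when_def if_distrib sum.delta cong: if_cong)

lemma cd_unit_in_carrier: "j < 2 ^ n \<Longrightarrow> cd_unit j \<in> cd_carrier n"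
  by (auto simp: cd_carrier_def lookup_single when_def)

lemma cd_eq_0_iff: "x \<in> cd_carrier n \<Longrightarrow> x = 0 \<longleftrightarrow> (\<forall>j<2 ^ n. coord x j = 0)"
  by (auto simp: cd_carrier_def poly_mapping_eq_iff fun_eq_iff not_less[symmetric])

lemma cd_dot_self_eq_0_iff: "x \<in> cd_carrier n \<Longrightarrow> cd_dot n x x = 0 \<longleftrightarrow> x = 0"
  by (auto simp: cd_eq_0_iff cd_dot_def sum_nonneg_eq_0_iff)

text \<open>An arbitrary length \<open>k\<close> lets the induction remove one coordinate at a time;
  \<open>k = 2 ^ n\<close> is the case of \<open>cd_carrier n\<close>.\<close>

lemma cd_initial_dim:
  "{x :: cd. \<forall>i\<ge>k. coord x i = 0} \<subseteq> span (cd_unit ` {..<k}) \<and> dim {x :: cd. \<forall>i\<ge>k. coord x i = 0} = k"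
proof (induction k)
  case 0
  have "{x :: cd. \<forall>i\<ge>0. coord x i = 0} = {0}"
    by (auto simp: poly_mapping_eq_iff fun_eq_iff)
  moreover have "dim {0 :: cd} = 0" by (subst dim_eq_card[of "{}"]) (simp_all add: independent_empty)
  ultimately show ?case by simp
next
  case (Suc k)
  let ?S = "\<lambda>k. {x :: cd. \<forall>i\<ge>k. coord x i = 0}"
  have sub: "?S (Suc k) \<subseteq> span (cd_unit ` {..<Suc k})"
  proof
    fix x assume x: "x \<in> ?S (Suc k)"
    have "x - coord x k *\<^sub>R cd_unit k \<in> ?S k"
    proof (safe)
      fix i assume "i \<ge> k"
      then show "coord (x - coord x k *\<^sub>R cd_unit k) i = 0"
        using x by (cases "i = k") (auto simp: lookup_minus lookup_scaleR_cd lookup_single when_def)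
    qed
    then have "x - coord x k *\<^sub>R cd_unit k \<in> span (cd_unit ` {..<k})" using Suc.IH by blast
    then show "x \<in> span (cd_unit ` {..<Suc k})"
      by (auto simp: lessThan_Suc span_insert)
  qed
  have "subspace (?S (Suc k))" by (auto simp: subspace_def lookup_add lookup_scaleR_cd)
  then have "dim (?S (Suc k)) = Suc (dim {x \<in> ?S (Suc k). coord x k = 0})"
    using sub by (intro dim_linear_kernel[of "cd_unit ` {..<Suc k}" _ _ "cd_unit k"])
      (auto simp: linear_coord lookup_single when_def)
  moreover have "{x \<in> ?S (Suc k). coord x k = 0} = ?S k"
    by (auto simp: Suc_le_eq) (metis order_le_less)
  ultimately show ?case using Suc.IH sub by simp
qed

lemma cd_carrier_subset_span: "cd_carrier n \<subseteq> span (cd_unit ` {..<2 ^ n})"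
  using cd_initial_dim[of "2 ^ n"] by (simp add: cd_carrier_def)

lemma dim_cd_carrier: "dim (cd_carrier n) = 2 ^ n"
  using cd_initial_dim[of "2 ^ n"] by (simp add: cd_carrier_def)

subsection \<open>Annihilators as radicals\<close>

lemma cd_i_eq_unit: "n \<ge> 1 \<Longrightarrow> cd_i n = cd_unit (2 ^ (n - 1))"
  by (rule poly_mapping_eqI)
    (auto simp: cd_i_def cd_one_def cd_pair.rep_eq lookup_one lookup_single when_def)

lemma cd_i_in_carrier: "n \<ge> 1 \<Longrightarrow> cd_i n \<in> cd_carrier n"
  by (simp add: cd_i_eq_unit cd_unit_in_carrier)

lemma coord_0_cd_i: "n \<ge> 1 \<Longrightarrow> coord (cd_i n) 0 = 0"
  by (simp add: cd_i_eq_unit lookup_single when_def)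

text \<open>The elements 1 and i_n are the unit vectors with indices 0 and
  \<open>2 ^ (n - 1)\<close>, so orthogonality to their span is a condition on these two
  coordinates.\<close>

lemma cd_C_perp_iff:
  assumes "n \<ge> 1"
  shows "x \<in> cd_C_perp n \<longleftrightarrow> x \<in> cd_carrier n \<and> coord x 0 = 0 \<and> coord x (2 ^ (n - 1)) = 0"
proof (cases "x \<in> cd_carrier n")
  case True
  have C: "cd_C n \<subseteq> cd_carrier n"
    unfolding cd_C_def
    by (rule span_minimal) (use assms in \<open>auto simp: cd_one_in_carrier cd_i_in_carrier subspace_cd_carrier\<close>)
  have lt: "(2::nat) ^ (n - 1) < 2 ^ n" using assms by simp
  have one: "cd_dot n x cd_one = coord x 0"
    using cd_dot_unit[of 0 n x] by (simp add: cd_one_def)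
  have i: "cd_dot n x (cd_i n) = coord x (2 ^ (n - 1))"
    unfolding cd_i_eq_unit[OF assms] by (rule cd_dot_unit[OF lt])
  have "(\<forall>y\<in>cd_C n. cd_inner n x y = 0) \<longleftrightarrow> (\<forall>y\<in>cd_C n. cd_dot n x y = 0)"
    using C True cd_inner_eq_dot by (metis subsetD)
  also have "\<dots> \<longleftrightarrow> (\<forall>y\<in>{cd_one, cd_i n}. cd_dot n x y = 0)"
    unfolding cd_C_def using linear_eq_0_on_span[OF linear_cd_dot(1)[of n x]] span_base by metis
  finally show ?thesis using True by (simp add: cd_C_perp_def one i)
qed (simp add: cd_C_perp_def)

lemma cd_C_perpD:
  assumes "n \<ge> 1" "x \<in> cd_C_perp n"
  shows "x \<in> cd_carrier n" "coord x 0 = 0"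
  using assms by (simp_all add: cd_C_perp_iff)

lemma subspace_cd_C_perp: "n \<ge> 1 \<Longrightarrow> subspace (cd_C_perp n)"
  using subspace_cd_carrier[of n]
  by (auto simp: subspace_def cd_C_perp_iff lookup_add lookup_scaleR_cd)

lemma cd_C_perp_SucE:
  assumes "x \<in> cd_C_perp (Suc n)"
  obtains a b where "a \<in> cd_carrier n" "b \<in> cd_carrier n" "x = cd_pair n a b"
    "coord a 0 = 0" "coord b 0 = 0"
proof -
  have x: "x \<in> cd_carrier (Suc n)" "coord x 0 = 0" "coord x (2 ^ n) = 0"
    using assms by (simp_all add: cd_C_perp_iff)
  from x(1) obtain a b where "a \<in> cd_carrier n" "b \<in> cd_carrier n" "x = cd_pair n a b"
    by (elim cd_carrier_SucE)
  then show ?thesis using x(2,3) by (intro that[of a b]) (simp_all add: cd_pair.rep_eq)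
qed

lemma cd_i_mult_pair:
  assumes "a \<in> cd_carrier n" "b \<in> cd_carrier n"
  shows "cd_mult (Suc n) (cd_i (Suc n)) (cd_pair n a b) = cd_pair n (- cd_conj n b) (cd_conj n a)"
  using assms
  by (simp add: cd_i_def cd_mult_pair cd_closed cd_mult_simps cd_mult_one)

lemma cd_i_mult_in_carrier:
  "n \<ge> 1 \<Longrightarrow> x \<in> cd_carrier n \<Longrightarrow> cd_mult n (cd_i n) x \<in> cd_carrier n"
  by (simp add: cd_mult_in_carrier cd_i_in_carrier)

lemma cd_i_mult_i_mult:
  assumes "n \<ge> 1" "x \<in> cd_carrier n"
  shows "cd_mult n (cd_i n) (cd_mult n (cd_i n) x) = - x"
proof -
  obtain m where n: "n = Suc m" using assms(1) by (cases n) auto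
  from assms(2) obtain a b where "x = cd_pair m a b" "a \<in> cd_carrier m" "b \<in> cd_carrier m"
    unfolding n by (elim cd_carrier_SucE)
  then show ?thesis
    by (simp add: n cd_i_mult_pair cd_closed cd_conj_simps cd_conj_conj cd_pair_uminus)
qed

text \<open>Both halves of \<open>a\<close> are imaginary, so conjugation negates them, and the pair
  formulas of the two sides then agree. This is the compatibility of the form
  \<open><a x, y>\<close> with the complex structure given by i_n.\<close>

lemma cd_mult_i_mult:
  assumes "n \<ge> 1" "a \<in> cd_C_perp n" "x \<in> cd_carrier n"
  shows "cd_mult n a (cd_mult n (cd_i n) x) = - cd_mult n (cd_i n) (cd_mult n a x)"
proof -
  obtain m where n: "n = Suc m" using assms(1) by (cases n) auto
  from assms(2) obtain p q where a: "p \<in> cd_carrier m" "q \<in> cd_carrier m" "a = cd_pair m p q"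
    "coord p 0 = 0" "coord q 0 = 0" unfolding n by (elim cd_C_perp_SucE)
  from assms(3) obtain c d where x: "c \<in> cd_carrier m" "d \<in> cd_carrier m" "x = cd_pair m c d"
    unfolding n by (elim cd_carrier_SucE)
  have conj: "cd_conj m p = - p" "cd_conj m q = - q"
    using a by (simp_all add: cd_conj_imaginary)
  show ?thesis
    using a x
    by (simp add: n conj cd_i_mult_pair cd_mult_pair cd_closed cd_conj_simps cd_mult_simps cd_conj_conj
        cd_mult_conj cd_pair_uminus minus_diff_commute)
qed

lemma cd_dot_i_mult:
  assumes "n \<ge> 1" "x \<in> cd_carrier n" "y \<in> cd_carrier n"
  shows "cd_dot n (cd_mult n (cd_i n) x) y = - cd_dot n x (cd_mult n (cd_i n) y)"
  by (rule cd_dot_imaginary) (use assms in \<open>simp_all add: cd_i_in_carrier coord_0_cd_i\<close>)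

lemma cd_dot_i_mult_i_mult:
  assumes "n \<ge> 1" "x \<in> cd_carrier n" "y \<in> cd_carrier n"
  shows "cd_dot n (cd_mult n (cd_i n) x) (cd_mult n (cd_i n) y) = cd_dot n x y"
  using assms by (simp add: cd_dot_i_mult cd_i_mult_in_carrier cd_i_mult_i_mult cd_dot_simps)

text \<open>If \<open>a x\<close> is orthogonal to everything, it is orthogonal to itself, and the
  inner product is positive definite.\<close>

lemma cd_Ann_eq_radical:
  assumes "a \<in> cd_carrier n"
  shows "cd_Ann n a = {x \<in> cd_carrier n. \<forall>y\<in>cd_carrier n. cd_dot n (cd_mult n a x) y = 0}"
proof -
  have "cd_mult n a x = 0"
    if "x \<in> cd_carrier n" "\<forall>y\<in>cd_carrier n. cd_dot n (cd_mult n a x) y = 0" for x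
    using that assms cd_dot_self_eq_0_iff[of "cd_mult n a x" n] by (simp add: cd_mult_in_carrier)
  then show ?thesis by (auto simp: cd_Ann_def cd_dot_simps)
qed

lemma linear_cd_dot_mult:
  "linear (\<lambda>x. cd_dot n (cd_mult n a x) y)" "linear (cd_dot n (cd_mult n a x))"
  using linear_compose[OF linear_cd_mult(1) linear_cd_dot(2)] linear_cd_dot(1)
  by (simp_all add: o_def)

text \<open>The complex structure is left multiplication by i_n. The codimension of the radical is
  divisible by 4, and so is the full dimension \<open>2 ^ n\<close>, because
  \<open>n \<ge> 2\<close>.\<close>

lemma dim_cd_Ann_dvd_4:
  assumes "n \<ge> 2" "a \<in> cd_C_perp n"
  shows "4 dvd dim (cd_Ann n a)"
proof -
  have n: "n \<ge> 1" using assms(1) by simp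
  note a = cd_C_perpD[OF n assms(2)]
  let ?\<omega> = "\<lambda>x y. cd_dot n (cd_mult n a x) y"
  have "\<exists>k. dim (cd_carrier n) = dim {x \<in> cd_carrier n. \<forall>y\<in>cd_carrier n. ?\<omega> x y = 0} + 4 * k"
  proof (rule dim_minus_dim_radical_dvd_4[where J = "cd_mult n (cd_i n)" and \<omega> = ?\<omega>,
        OF _ cd_carrier_subset_span subspace_cd_carrier linear_cd_dot_mult])
    fix x y assume xy: "x \<in> cd_carrier n" "y \<in> cd_carrier n"
    show "?\<omega> y x = - ?\<omega> x y"
      using cd_dot_imaginary[OF a xy] by (simp add: cd_dot_commute)
    \<comment> \<open>Two signs cancel: one from moving i_n past \<open>a\<close>, the other from
      the skewness of left multiplication by i_n.\<close>
    show "?\<omega> (cd_mult n (cd_i n) x) y = ?\<omega> x (cd_mult n (cd_i n) y)"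
      using xy n a by (simp add: cd_mult_i_mult[OF n assms(2)] cd_dot_simps cd_dot_i_mult cd_mult_in_carrier)
  qed (use n in \<open>simp_all add: cd_i_mult_in_carrier cd_i_mult_i_mult\<close>)
  then obtain k where "2 ^ n = dim (cd_Ann n a) + 4 * k"
    by (auto simp: cd_Ann_eq_radical[OF a(1)] dim_cd_carrier)
  moreover have "(4::nat) dvd 2 ^ n"
    using le_imp_power_dvd[OF assms(1), of "2::nat"] by simp
  ultimately show ?thesis
    by (metis dvd_add_left_iff dvd_triv_left)
qed

text \<open>Arguments and test vectors are confined to the space from which braces are formed. In
  comparison with \<open>cd_Ann\<close>, the test vectors 1 and i_n are missing.\<close>

definition cd_radical :: "nat \<Rightarrow> cd \<Rightarrow> cd set" where
  "cd_radical n a = {x \<in> cd_C_perp n. \<forall>y\<in>cd_C_perp n. cd_dot n (cd_mult n a x) y = 0}"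

lemma subspace_cd_radical: "n \<ge> 1 \<Longrightarrow> subspace (cd_radical n a)"
  using subspace_cd_C_perp[of n]
  by (auto simp: subspace_def cd_radical_def cd_mult_simps cd_dot_simps)

lemma cd_C_perp_i_mult:
  assumes "n \<ge> 1" "x \<in> cd_C_perp n"
  shows "cd_mult n (cd_i n) x \<in> cd_C_perp n"
proof -
  obtain m where n: "n = Suc m" using assms(1) by (cases n) auto
  from assms(2) obtain p q where x: "p \<in> cd_carrier m" "q \<in> cd_carrier m" "x = cd_pair m p q"
    "coord p 0 = 0" "coord q 0 = 0" unfolding n by (elim cd_C_perp_SucE)
  then show ?thesis
    by (simp add: n cd_i_mult_pair cd_C_perp_iff cd_closed cd_pair.rep_eq lookup_cd_conj)
qed

text \<open>The square of an imaginary element is fixed by conjugation, hence equals its real part,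
  which is the inner product of \<open>a\<close> with its conjugate \<open>- a\<close>.\<close>

lemma cd_square_imaginary:
  assumes "a \<in> cd_carrier n" "coord a 0 = 0"
  shows "cd_mult n a a = - cd_dot n a a *\<^sub>R cd_one"
proof -
  have "cd_conj n (cd_mult n a a) = cd_mult n a a"
    using assms by (simp add: cd_mult_conj cd_conj_imaginary cd_mult_simps)
  then have "cd_mult n a a = cd_Re n (cd_mult n a a)"
    by (simp add: cd_Re_def scaleR_2[symmetric])
  also have "\<dots> = - cd_dot n a a *\<^sub>R cd_one"
    using assms by (simp add: cd_Re_eq cd_closed coord_0_cd_mult cd_conj_imaginary cd_dot_simps)
  finally show ?thesis .
qed

text \<open>The radical of the form \<open>\<langle>a x, y\<rangle>\<close> on \<open>\<complex>\<^sub>n\<^sup>\<bottom>\<close> is \<open>Ann(a) \<oplus> \<complex>\<^sub>n a\<close>.\<close>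

lemma dim_cd_radical:
  assumes "n \<ge> 1" "a \<in> cd_C_perp n" "a \<noteq> 0"
  shows "dim (cd_radical n a) = dim (cd_Ann n a) + 2"
proof -
  note n = assms(1)
  note a = cd_C_perpD[OF assms(1,2)]
  define l where "l = cd_dot n a a"
  have l: "l \<noteq> 0" using assms(3) a by (simp add: l_def cd_dot_self_eq_0_iff)
  have aa: "cd_mult n a a = - l *\<^sub>R cd_one" unfolding l_def by (rule cd_square_imaginary[OF a])
  define ia where "ia = cd_mult n (cd_i n) a"
  have ia: "ia \<in> cd_C_perp n" "ia \<in> cd_carrier n"
    using cd_C_perp_i_mult[OF assms(1,2)] cd_C_perpD[OF n] by (simp_all add: ia_def)
  have a_ia: "cd_mult n a ia = l *\<^sub>R cd_i n"
    using a n by (simp add: ia_def cd_mult_i_mult[OF n assms(2)] aa cd_mult_simps cd_mult_one cd_i_in_carrier)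
  have lt: "(2::nat) ^ (n - 1) < 2 ^ n" using n by simp
  have one: "cd_dot n x cd_one = coord x 0" for x
    using cd_dot_unit[of 0 n x] by (simp add: cd_one_def)
  have i: "cd_dot n x (cd_i n) = coord x (2 ^ (n - 1))" for x
    unfolding cd_i_eq_unit[OF n] by (rule cd_dot_unit[OF lt])
  have perp: "cd_dot n cd_one y = 0" "cd_dot n (cd_i n) y = 0" if "y \<in> cd_C_perp n" for y
    using that one[of y] i[of y] cd_C_perp_iff[OF n] by (simp_all add: cd_dot_commute)
  \<comment> \<open>These functionals restore the missing tests against 1 and i_n. They are
    independent on the radical: \<open>a\<close> and \<open>ia\<close> lie in it, and
    \<open>a\<close> times them is \<open>- l\<close> times 1 and \<open>l\<close> times i_n
    respectively.\<close>
  let ?f1 = "\<lambda>x. cd_dot n (cd_mult n a x) cd_one" and ?f2 = "\<lambda>x. cd_dot n (cd_mult n a x) (cd_i n)"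
  let ?K1 = "{x \<in> cd_radical n a. ?f1 x = 0}"
  let ?K2 = "{x \<in> ?K1. ?f2 x = 0}"
  have rad: "a \<in> cd_radical n a" "ia \<in> cd_radical n a"
    using assms(2) ia(1) by (simp_all add: cd_radical_def aa a_ia cd_dot_simps perp)
  have sub: "cd_radical n a \<subseteq> span (cd_unit ` {..<2 ^ n})"
    using cd_carrier_subset_span cd_C_perpD[OF n] unfolding cd_radical_def by blast
  have ones: "cd_dot n cd_one cd_one = 1" "cd_dot n (cd_i n) cd_one = 0" "cd_dot n (cd_i n) (cd_i n) = 1"
    unfolding one i using n
    by (simp_all add: cd_one_def coord_0_cd_i lookup_one cd_i_eq_unit lookup_single)
  have "dim (cd_radical n a) = Suc (dim ?K1)"
    by (rule dim_linear_kernel[OF _ sub subspace_cd_radical[OF n] linear_cd_dot_mult(1) rad(1)])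
      (simp_all add: aa cd_dot_simps ones l)
  moreover have "dim ?K1 = Suc (dim ?K2)"
  proof (rule dim_linear_kernel[where z = ia, OF _ _ _ linear_cd_dot_mult(1)])
    show "subspace ?K1"
      using subspace_cd_radical[OF n] by (auto simp: subspace_def cd_mult_simps cd_dot_simps)
    show "?K1 \<subseteq> span (cd_unit ` {..<2 ^ n})" using sub by blast
    show "ia \<in> ?K1" using rad by (simp add: a_ia cd_dot_simps ones)
    show "?f2 ia \<noteq> 0" using l by (simp add: a_ia cd_dot_simps ones)
  qed simp
  moreover have "?K2 = cd_Ann n a"
  proof (intro set_eqI iffI)
    fix x assume x: "x \<in> ?K2"
    then have xP: "x \<in> cd_C_perp n" and xr: "\<forall>y\<in>cd_C_perp n. cd_dot n (cd_mult n a x) y = 0"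
      by (simp_all add: cd_radical_def)
    note xc = cd_C_perpD(1)[OF n xP]
    \<comment> \<open>Once both functionals vanish, \<open>a x\<close> itself is an admissible test
      vector.\<close>
    have "cd_mult n a x \<in> cd_C_perp n"
      using x xc a by (simp add: cd_C_perp_iff[OF n] one i cd_mult_in_carrier)
    then have "cd_dot n (cd_mult n a x) (cd_mult n a x) = 0" using xr by blast
    then show "x \<in> cd_Ann n a"
      using xc a by (simp add: cd_Ann_def cd_dot_self_eq_0_iff cd_mult_in_carrier)
  next
    fix x assume "x \<in> cd_Ann n a"
    then have x: "x \<in> cd_carrier n" "cd_mult n a x = 0" by (simp_all add: cd_Ann_def)
    have "cd_dot n x (cd_mult n a y) = 0" if "y \<in> cd_carrier n" for y
      using cd_dot_imaginary[OF a x(1) that] x(2) by (simp add: cd_dot_simps)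
    \<comment> \<open>The choices \<open>y = a\<close> and \<open>y = ia\<close> make
      \<open>a y\<close> a non-zero multiple of 1 and of i_n, so the annihilator of \<open>a\<close>
      is orthogonal to both.\<close>
    from this[OF a(1)] this[OF ia(2)] have "coord x 0 = 0" "coord x (2 ^ (n - 1)) = 0"
      using l by (simp_all add: aa a_ia cd_dot_simps one i)
    then show "x \<in> ?K2"
      using x by (simp add: cd_radical_def cd_C_perp_iff[OF n] cd_dot_simps)
  qed
  ultimately show ?thesis by simp
qed

subsection \<open>The form of a brace\<close>

text \<open>The first identity is skewness of left multiplication by \<open>x\<close>; the second
  holds because conjugation is isometric, reverses products and negates imaginary elements. Together
  they make \<open><x y, z>\<close> an alternating trilinear form.\<close>

lemma cd_triple_skew:
  assumes "n \<ge> 1" "x \<in> cd_C_perp n" "y \<in> cd_C_perp n" "z \<in> cd_C_perp n"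
  shows "cd_dot n (cd_mult n x z) y = - cd_dot n (cd_mult n x y) z"
    and "cd_dot n (cd_mult n y x) z = - cd_dot n (cd_mult n x y) z"
proof -
  note x = cd_C_perpD[OF assms(1,2)] and y = cd_C_perpD[OF assms(1,3)]
    and z = cd_C_perpD[OF assms(1,4)]
  show "cd_dot n (cd_mult n x z) y = - cd_dot n (cd_mult n x y) z"
    using cd_dot_imaginary[OF x y(1) z(1)] by (simp add: cd_dot_commute)
  have "cd_dot n (cd_conj n (cd_mult n x y)) (cd_conj n z) = cd_dot n (cd_mult n x y) z"
    using x y z by (simp add: cd_dot_conj cd_mult_in_carrier)
  then show "cd_dot n (cd_mult n y x) z = - cd_dot n (cd_mult n x y) z"
    using x y z by (simp add: cd_mult_conj cd_conj_imaginary cd_mult_simps cd_dot_simps)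
qed

text \<open>Left multiplication by i_n is isometric and anticommutes with that by \<open>x\<close>,
  which gives the first identity; antisymmetry carries it to the other two pairs of slots. Thus the
  trilinear form is the real part of a complex trilinear one.\<close>

lemma cd_triple_i:
  assumes "n \<ge> 1" "x \<in> cd_C_perp n" "y \<in> cd_C_perp n" "z \<in> cd_C_perp n"
  shows "cd_dot n (cd_mult n x (cd_mult n (cd_i n) y)) (cd_mult n (cd_i n) z)
      = - cd_dot n (cd_mult n x y) z"
    and "cd_dot n (cd_mult n (cd_mult n (cd_i n) x) y) (cd_mult n (cd_i n) z)
      = - cd_dot n (cd_mult n x y) z"
    and "cd_dot n (cd_mult n (cd_mult n (cd_i n) x) (cd_mult n (cd_i n) y)) z
      = - cd_dot n (cd_mult n x y) z"
proof -
  let ?I = "cd_mult n (cd_i n)"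
  note n = assms(1)
  note skew = cd_triple_skew[OF n] and perp = cd_C_perp_i_mult[OF n]
  have 1: "cd_dot n (cd_mult n u (?I v)) (?I w) = - cd_dot n (cd_mult n u v) w"
    if "u \<in> cd_C_perp n" "v \<in> cd_C_perp n" "w \<in> cd_C_perp n" for u v w
    using that cd_C_perpD[OF n]
    by (simp add: cd_mult_i_mult[OF n] cd_dot_simps cd_dot_i_mult_i_mult[OF n] cd_mult_in_carrier)
  show "cd_dot n (cd_mult n x (?I y)) (?I z) = - cd_dot n (cd_mult n x y) z"
    by (rule 1[OF assms(2-4)])
  have "cd_dot n (cd_mult n (?I x) y) (?I z) = - cd_dot n (cd_mult n y (?I x)) (?I z)"
    by (rule skew(2); simp add: assms perp)
  also have "\<dots> = cd_dot n (cd_mult n y x) z" by (simp add: 1 assms)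
  also have "\<dots> = - cd_dot n (cd_mult n x y) z" by (rule skew(2); simp add: assms)
  finally show "cd_dot n (cd_mult n (?I x) y) (?I z) = - cd_dot n (cd_mult n x y) z" .
  have "cd_dot n (cd_mult n (?I x) (?I y)) z = - cd_dot n (cd_mult n (?I x) z) (?I y)"
    by (rule skew(1); simp add: assms perp)
  also have "\<dots> = cd_dot n (cd_mult n z (?I x)) (?I y)"
    using skew(2)[of z "?I x" "?I y"] by (simp add: assms perp)
  also have "\<dots> = - cd_dot n (cd_mult n z x) y" by (simp add: 1 assms)
  also have "\<dots> = cd_dot n (cd_mult n x z) y" using skew(2)[of x z y] by (simp add: assms)
  also have "\<dots> = - cd_dot n (cd_mult n x y) z" by (rule skew(1); simp add: assms)
  finally show "cd_dot n (cd_mult n (?I x) (?I y)) z = - cd_dot n (cd_mult n x y) z" .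
qed

lemma cd_brace_add: "cd_brace n a b + cd_brace n c d = cd_brace n (a + c) (b + d)"
proof -
  have "cd_pair n (a + b) (cd_mult n (cd_i n) (- a + b)) + cd_pair n (c + d) (cd_mult n (cd_i n) (- c + d))
      = cd_pair n (a + c + (b + d)) (cd_mult n (cd_i n) (- (a + c) + (b + d)))"
    unfolding cd_pair_add linear_add[OF linear_cd_mult(1), symmetric] by (simp add: algebra_simps)
  then show ?thesis unfolding cd_brace_def scaleR_add_right[symmetric] by simp
qed

lemma cd_brace_scaleR: "r *\<^sub>R cd_brace n a b = cd_brace n (r *\<^sub>R a) (r *\<^sub>R b)"
  by (simp add: cd_brace_def cd_pair_scaleR cd_mult_simps algebra_simps)

text \<open>Left multiplication by i_n is isometric, the cross terms from the sums and the
  differences cancel, and the factor \<open>1 / sqrt 2\<close> absorbs the remaining 2.\<close>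

lemma cd_dot_brace:
  assumes "n \<ge> 1" "x \<in> cd_carrier n" "y \<in> cd_carrier n" "z \<in> cd_carrier n" "w \<in> cd_carrier n"
  shows "cd_dot (Suc n) (cd_brace n x y) (cd_brace n z w) = cd_dot n x z + cd_dot n y w"
proof -
  have "cd_dot n (cd_mult n (cd_i n) (- x + y)) (cd_mult n (cd_i n) (- z + w)) = cd_dot n (- x + y) (- z + w)"
    using assms by (intro cd_dot_i_mult_i_mult) (simp_all add: cd_closed)
  then show ?thesis
    by (simp add: cd_brace_def cd_dot_pair cd_dot_simps field_simps)
qed

lemma cd_brace_eq_0_iff:
  assumes "n \<ge> 1" "x \<in> cd_carrier n" "y \<in> cd_carrier n"
  shows "cd_brace n x y = 0 \<longleftrightarrow> x = 0 \<and> y = 0"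
proof
  assume "cd_brace n x y = 0"
  then have "cd_dot (Suc n) (cd_brace n x y) (cd_brace n z w) = 0" for z w
    by (simp add: cd_dot_simps)
  from this[of x 0] this[of 0 y] show "x = 0 \<and> y = 0"
    using assms by (simp add: cd_dot_brace cd_closed cd_dot_simps cd_dot_self_eq_0_iff)
qed (simp add: cd_brace_def cd_mult_simps cd_pair_0)

text \<open>This is the decoupling of the two entries of a brace: after i_n is eliminated from the
  expansion, all trilinear terms mixing \<open>a, x, z\<close> with \<open>b, y, w\<close>
  cancel.\<close>

lemma cd_dot_mult_brace:
  assumes n: "n \<ge> 1"
    and perp: "a \<in> cd_C_perp n" "b \<in> cd_C_perp n" "x \<in> cd_C_perp n" "y \<in> cd_C_perp n"
      "z \<in> cd_C_perp n" "w \<in> cd_C_perp n"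
  shows "cd_dot (Suc n) (cd_mult (Suc n) (cd_brace n a b) (cd_brace n x y)) (cd_brace n z w)
    = sqrt 2 * (cd_dot n (cd_mult n a x) z + cd_dot n (cd_mult n b y) w)"
proof -
  let ?I = "cd_mult n (cd_i n)"
  let ?T = "\<lambda>u v w. cd_dot n (cd_mult n u v) w"
  define p q r s k l where "p = a + b" and "q = - a + b" and "r = x + y" and "s = - x + y"
    and "k = z + w" and "l = - z + w"
  note sub = subspace_cd_C_perp[OF n]
  have mem: "p \<in> cd_C_perp n" "q \<in> cd_C_perp n" "r \<in> cd_C_perp n" "s \<in> cd_C_perp n"
    "k \<in> cd_C_perp n" "l \<in> cd_C_perp n"
    unfolding p_def q_def r_def s_def k_def l_def using perp
    by (auto intro!: subspace_add[OF sub] subspace_diff[OF sub])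
  note car = mem[THEN cd_C_perpD(1)[OF n]] mem[THEN cd_C_perp_i_mult[OF n], THEN cd_C_perpD(1)[OF n]]
  have conj: "cd_conj n r = - r" "cd_conj n (?I s) = - ?I s"
    using mem(3,4) cd_C_perpD[OF n] cd_C_perp_i_mult[OF n] by (auto intro!: cd_conj_imaginary)
  have "cd_dot (Suc n) (cd_mult (Suc n) (cd_pair n p (?I q)) (cd_pair n r (?I s))) (cd_pair n k (?I l))
      = ?T p r k + ?T (?I s) (?I q) k + ?T (?I s) p (?I l) - ?T (?I q) r (?I l)"
    by (simp add: cd_mult_pair car conj cd_dot_pair cd_mult_simps cd_dot_simps)
  \<comment> \<open>In each of the last three terms i_n occurs in exactly two slots, and is removed
    at the price of a sign.\<close>
  also have "\<dots> = ?T p r k - ?T s q k - ?T s p l + ?T q r l"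
    using mem by (simp add: cd_triple_i[OF n])
  also have "\<dots> = ?T p r k + ?T q s k + ?T p s l + ?T q r l"
    using cd_triple_skew(2)[OF n mem(2,4,5)] cd_triple_skew(2)[OF n mem(1,4,6)] by simp
  \<comment> \<open>The four terms carry the difference letters \<open>q\<close>, \<open>s\<close>,
    \<open>l\<close> in no slot or in exactly two. Hence the signs of a mixed monomial sum to 0,
    whereas those of the two pure monomials sum to 4.\<close>
  also have "\<dots> = 4 * (?T a x z + ?T b y w)"
    unfolding p_def q_def r_def s_def k_def l_def by (simp add: cd_mult_simps cd_dot_simps)
  finally have "cd_dot (Suc n) (cd_mult (Suc n) (cd_pair n p (?I q)) (cd_pair n r (?I s))) (cd_pair n k (?I l))
      = 4 * (?T a x z + ?T b y w)" .
  \<comment> \<open>Three braces contribute three factors \<open>1 / sqrt 2\<close>, which turn 4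
    into \<open>sqrt 2\<close>.\<close>
  moreover have "(4 * t + 4 * u) / (sqrt 2 * 2) = sqrt 2 * (t + u)" for t u :: real
  proof -
    have "(4 * t + 4 * u) / (sqrt 2 * 2) = 2 / sqrt 2 * (t + u)" by (simp add: field_simps)
    then show ?thesis by (simp add: real_div_sqrt)
  qed
  ultimately show ?thesis
    unfolding cd_brace_def p_def[symmetric] q_def[symmetric] r_def[symmetric] s_def[symmetric]
      k_def[symmetric] l_def[symmetric]
    by (simp add: cd_mult_simps cd_dot_simps)
qed

section \<open>The subspace of braces\<close>

lemma cd_brace_in_C_perp:
  assumes "n \<ge> 1" "a \<in> cd_C_perp n" "b \<in> cd_C_perp n"
  shows "cd_brace n a b \<in> cd_C_perp (Suc n)"
proof -
  note sub = subspace_cd_C_perp[OF assms(1)]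
  have "- a + b \<in> cd_C_perp n" using assms by (intro subspace_add[OF sub] subspace_neg[OF sub])
  from cd_C_perpD(2)[OF assms(1) cd_C_perp_i_mult[OF assms(1) this]]
  have "coord (cd_brace n a b) (2 ^ n) = 0"
    by (simp add: cd_brace_def lookup_scaleR_cd cd_pair.rep_eq)
  moreover have "coord (cd_brace n a b) 0 = 0"
    using assms cd_C_perpD(2)[OF assms(1)]
    by (simp add: cd_brace_def lookup_scaleR_cd cd_pair.rep_eq lookup_add)
  ultimately show ?thesis
    using cd_brace_in_carrier[of n a b] assms cd_C_perpD(1)[OF assms(1)] by (simp add: cd_C_perp_iff)
qed

text \<open>The four indices are the positions of 1 and i_n in each half of a pair: braces are
  exactly the pairs with both halves orthogonal to 1 and i_n.\<close>

lemma cd_braces_eq: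
  assumes "n \<ge> 1"
  shows "{cd_brace n x y |x y. x \<in> cd_C_perp n \<and> y \<in> cd_C_perp n}
    = {w \<in> cd_carrier (Suc n). \<forall>j\<in>{0, 2 ^ (n - 1), 2 ^ n, 2 ^ (n - 1) + 2 ^ n}. coord w j = 0}"
    (is "?B = ?P")
proof (intro set_eqI iffI)
  note sub = subspace_cd_C_perp[OF assms]
  have lt: "(2::nat) ^ (n - 1) < 2 ^ n" using assms by simp
  fix w
  {
    assume "w \<in> ?B"
    then obtain x y where w: "w = cd_brace n x y" "x \<in> cd_C_perp n" "y \<in> cd_C_perp n" by blast
    have "x + y \<in> cd_C_perp n" "cd_mult n (cd_i n) (- x + y) \<in> cd_C_perp n"
      using w by (auto intro!: cd_C_perp_i_mult assms subspace_add[OF sub] subspace_diff[OF sub])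
    then show "w \<in> ?P"
      using cd_brace_in_carrier[OF assms, of x y] w lt cd_C_perpD(1)[OF assms]
      by (simp add: cd_brace_def lookup_scaleR_cd cd_pair.rep_eq cd_C_perp_iff[OF assms])
  next
    assume w: "w \<in> ?P"
    then obtain k l where kl: "w = cd_pair n k l" "k \<in> cd_carrier n" "l \<in> cd_carrier n"
      by (auto elim: cd_carrier_SucE)
    then have perp: "k \<in> cd_C_perp n" "l \<in> cd_C_perp n"
      using w lt by (simp_all add: cd_C_perp_iff[OF assms] cd_pair.rep_eq)
    \<comment> \<open>The preimage of \<open>(k, l)\<close> is obtained by solving for the entries
      of the brace: their sum must be \<open>sqrt 2\<close> times \<open>k\<close>, and their
      difference is recovered from \<open>l\<close> because i_n acts with square -1.\<close>
    let ?s = "1 / sqrt 2" and ?I = "cd_mult n (cd_i n)"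
    have eq: "- (?s *\<^sub>R (k + ?I l)) + ?s *\<^sub>R (k - ?I l) = (- sqrt 2) *\<^sub>R ?I l"
    proof -
      have "- (?s *\<^sub>R (k + ?I l)) + ?s *\<^sub>R (k - ?I l) = (- 2 * ?s) *\<^sub>R ?I l"
        by (rule poly_mapping_eqI)
          (simp only: lookup_add lookup_minus lookup_uminus lookup_scaleR_cd, simp add: algebra_simps)
      then show ?thesis by (simp add: real_div_sqrt)
    qed
    have eq': "?s *\<^sub>R (k + ?I l) + ?s *\<^sub>R (k - ?I l) = sqrt 2 *\<^sub>R k"
    proof -
      have "?s *\<^sub>R (k + ?I l) + ?s *\<^sub>R (k - ?I l) = (2 * ?s) *\<^sub>R k"
        by (rule poly_mapping_eqI)
          (simp only: lookup_add lookup_minus lookup_uminus lookup_scaleR_cd, simp add: algebra_simps)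
      then show ?thesis by (simp add: real_div_sqrt)
    qed
    have "cd_brace n (?s *\<^sub>R (k + ?I l)) (?s *\<^sub>R (k - ?I l)) = w"
      unfolding cd_brace_def eq eq'
      by (simp add: linear_cd_mult(1)[THEN linear_scale] linear_cd_mult(1)[THEN linear_neg]
          cd_i_mult_i_mult[OF assms kl(3)] cd_pair_scaleR kl(1))
    moreover have "?s *\<^sub>R (k + ?I l) \<in> cd_C_perp n" "?s *\<^sub>R (k - ?I l) \<in> cd_C_perp n"
      using perp cd_C_perp_i_mult[OF assms perp(2)]
      by (auto intro!: subspace_scale[OF sub] subspace_add[OF sub] subspace_diff[OF sub])
    ultimately show "w \<in> ?B" by blast
  }
qed

section \<open>Comparison of Ann({a, b}) with the radical on the subspace of braces\<close>

theorem theorem1p3: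
  fixes n :: nat and a b :: cd
  assumes "n \<ge> 3"
    and "a \<in> cd_C_perp n" and "a \<noteq> 0"
    and "b \<in> cd_C_perp n" and "b \<noteq> 0"
  shows "dim (cd_Ann (Suc n) (cd_brace n a b)) = dim (cd_Ann n a) + dim (cd_Ann n b)
       \<or> dim (cd_Ann (Suc n) (cd_brace n a b)) = dim (cd_Ann n a) + dim (cd_Ann n b) + 4"
proof -
  have n: "n \<ge> 1" using assms(1) by simp
  note a = assms(2) and b = assms(4)
  note car = cd_C_perpD(1)[OF n]
  define J :: "nat set" where "J = {0, 2 ^ (n - 1), 2 ^ n, 2 ^ (n - 1) + 2 ^ n}"
  define P where "P = {w \<in> cd_carrier (Suc n). \<forall>j\<in>J. coord w j = 0}"
  define \<alpha> where "\<alpha> = cd_brace n a b"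
  define R where "R = {v \<in> P. \<forall>u\<in>P. cd_dot (Suc n) (cd_mult (Suc n) \<alpha> v) u = 0}"
  let ?U = "cd_unit ` {..<2 ^ Suc n}"
  let ?A = "cd_Ann (Suc n) \<alpha>"
  have J: "finite J" "card J \<le> 4" "J \<subseteq> {..<2 ^ Suc n}"
  proof -
    have "(2::nat) ^ (n - 1) < 2 ^ n" using n by simp
    moreover from this have "(2::nat) ^ (n - 1) < 2 * 2 ^ n" by linarith
    ultimately show "finite J" "card J \<le> 4" "J \<subseteq> {..<2 ^ Suc n}"
      by (auto simp: J_def card_insert_if)
  qed
  have P: "P = {cd_brace n x y |x y. x \<in> cd_C_perp n \<and> y \<in> cd_C_perp n}"
    unfolding P_def J_def by (rule cd_braces_eq[OF n, symmetric])
  have \<alpha>: "\<alpha> \<in> cd_C_perp (Suc n)" "\<alpha> \<in> cd_carrier (Suc n)" "coord \<alpha> 0 = 0"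
    using cd_brace_in_C_perp[OF n a b] cd_C_perpD[of "Suc n"] by (simp_all add: \<alpha>_def)
  note subU = cd_carrier_subset_span[of "Suc n"]
  have RU: "R \<subseteq> span ?U" and AU: "?A \<subseteq> span ?U"
    using subU by (auto simp: R_def P_def cd_Ann_def)
  have subP: "subspace P"
    using subspace_cd_carrier[of "Suc n"]
    by (auto simp: P_def subspace_def lookup_add lookup_scaleR_cd)
  then have subR: "subspace R"
    by (auto simp: R_def subspace_def cd_mult_simps cd_dot_simps)
  have subA: "subspace ?A"
    using subspace_cd_carrier[of "Suc n"]
    by (auto simp: cd_Ann_def subspace_def cd_mult_simps)

  have "R = {v + u |v u. v \<in> (\<lambda>x. cd_brace n x 0) ` cd_radical n a \<and> u \<in> cd_brace n 0 ` cd_radical n b}"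
    (is "_ = ?RR")
  proof (intro set_eqI iffI)
    fix v assume v: "v \<in> R"
    then obtain x y where xy: "v = cd_brace n x y" "x \<in> cd_C_perp n" "y \<in> cd_C_perp n"
      unfolding R_def P by blast
    have z: "cd_dot n (cd_mult n a x) z + cd_dot n (cd_mult n b y) w = 0"
      if "z \<in> cd_C_perp n" "w \<in> cd_C_perp n" for z w
    proof -
      have "cd_brace n z w \<in> P" unfolding P using that by blast
      then have "cd_dot (Suc n) (cd_mult (Suc n) \<alpha> v) (cd_brace n z w) = 0"
        using v by (simp add: R_def)
      then show ?thesis
        using cd_dot_mult_brace[OF n a b xy(2,3) that] by (simp add: xy(1) \<alpha>_def)
    qed
    \<comment> \<open>Test vectors with one entry zero separate the condition into one on
      \<open>x\<close> and one on \<open>y\<close>.\<close>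
    have 0: "0 \<in> cd_C_perp n" by (rule subspace_0[OF subspace_cd_C_perp[OF n]])
    have "x \<in> cd_radical n a" "y \<in> cd_radical n b"
      using xy z[OF _ 0] z[OF 0] by (auto simp: cd_radical_def cd_dot_simps)
    moreover have "v = cd_brace n x 0 + cd_brace n 0 y" by (simp add: xy(1) cd_brace_add)
    ultimately show "v \<in> ?RR" by blast
  next
    fix v assume "v \<in> ?RR"
    then obtain x y where xy: "v = cd_brace n x y" "x \<in> cd_radical n a" "y \<in> cd_radical n b"
      using cd_brace_add[of n _ 0 0] by auto
    then have perp: "x \<in> cd_C_perp n" "y \<in> cd_C_perp n" by (simp_all add: cd_radical_def)
    show "v \<in> R"
      using xy perp by (auto simp: R_def P \<alpha>_def cd_dot_mult_brace[OF n a b] cd_radical_def)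
  qed
  also have "dim \<dots> = dim ((\<lambda>x. cd_brace n x 0) ` cd_radical n a) + dim (cd_brace n 0 ` cd_radical n b)"
  proof (rule dim_direct_sum[where B = ?U])
    have lin: "linear (\<lambda>x. cd_brace n x 0)" "linear (cd_brace n 0)"
      by (rule linearI; simp add: cd_brace_add cd_brace_scaleR)+
    show "subspace ((\<lambda>x. cd_brace n x 0) ` cd_radical n a)" "subspace (cd_brace n 0 ` cd_radical n b)"
      using lin subspace_cd_radical[OF n] by (auto intro: linear_subspace_image)
    show "(\<lambda>x. cd_brace n x 0) ` cd_radical n a \<subseteq> span ?U" "cd_brace n 0 ` cd_radical n b \<subseteq> span ?U"
      using subU cd_brace_in_carrier[OF n] car cd_closed(8)
      by (auto simp: cd_radical_def intro!: subsetD[OF subU])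
    show "(\<lambda>x. cd_brace n x 0) ` cd_radical n a \<inter> cd_brace n 0 ` cd_radical n b \<subseteq> {0}"
    proof safe
      fix x y assume "x \<in> cd_radical n a" "y \<in> cd_radical n b" and e: "cd_brace n x 0 = cd_brace n 0 y"
      then have "x \<in> cd_carrier n" "y \<in> cd_carrier n" using car by (auto simp: cd_radical_def)
      moreover have "cd_brace n x (- y) = 0"
        using e cd_brace_add[of n x 0 0 "- y"] cd_brace_add[of n 0 y 0 "- y"]
          cd_brace_scaleR[of 0 n 0 0] by simp
      ultimately show "cd_brace n x 0 = 0"
        by (simp add: cd_brace_eq_0_iff[OF n] cd_closed)
    qed
  qed simp
  also have "\<dots> = dim (cd_radical n a) + dim (cd_radical n b)"
  proof -
    have lin: "linear (\<lambda>x. cd_brace n x 0)" "linear (cd_brace n 0)"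
      by (rule linearI; simp add: cd_brace_add cd_brace_scaleR)+
    have "cd_radical n c \<subseteq> cd_carrier n" for c using car by (auto simp: cd_radical_def)
    then have "inj_on (\<lambda>x. cd_brace n x 0) (cd_radical n a)" "inj_on (cd_brace n 0) (cd_radical n b)"
      unfolding linear_inj_on_iff_eq_0[OF lin(1) subspace_cd_radical[OF n]]
        linear_inj_on_iff_eq_0[OF lin(2) subspace_cd_radical[OF n]]
      by (auto simp: cd_brace_eq_0_iff[OF n] cd_closed subset_iff)
    then show ?thesis
      using dim_injective_image lin subspace_cd_radical[OF n] by metis
  qed
  also have "\<dots> = dim (cd_Ann n a) + dim (cd_Ann n b) + 4"
    using dim_cd_radical[OF n] assms by simp
  finally have dimR: "dim R = dim (cd_Ann n a) + dim (cd_Ann n b) + 4" .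

  \<comment> \<open>For \<open>v\<close> in \<open>R\<close>, the product of \<open>\<alpha>\<close>
    with \<open>v\<close> is orthogonal to \<open>P\<close>, so only its coordinates in
    \<open>J\<close> can be non-zero. Requiring these to vanish costs at most 4 dimensions and
    leaves annihilating elements.\<close>
  have "dim R \<le> dim ?A + 4"
  proof -
    let ?f = "\<lambda>j v. coord (cd_mult (Suc n) \<alpha> v) j"
    let ?K = "{v \<in> R. \<forall>j\<in>J. ?f j v = 0}"
    have "linear (?f j)" for j
      using linear_compose[OF linear_cd_mult(1) linear_coord] by (simp add: o_def)
    then have "dim R \<le> dim ?K + card J"
      by (intro dim_le_dim_kernel_add_card[OF _ RU subR J(1)]) auto
    also have "?K \<subseteq> ?A"
    proof
      fix v assume v: "v \<in> ?K"
      then have vc: "v \<in> cd_carrier (Suc n)" by (simp add: R_def P_def)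
      have "coord (cd_mult (Suc n) \<alpha> v) j = 0" if j: "j < 2 ^ Suc n" for j
      proof (cases "j \<in> J")
        case False
        then have "cd_unit j \<in> P"
          using cd_unit_in_carrier[OF j] by (auto simp: P_def lookup_single when_def)
        then show ?thesis
          using v cd_dot_unit[OF j] by (auto simp: R_def)
      qed (use v in simp)
      then show "v \<in> ?A"
        using vc \<alpha>(2) cd_eq_0_iff[of "cd_mult (Suc n) \<alpha> v" "Suc n"]
        by (simp add: cd_Ann_def cd_mult_in_carrier)
    qed
    then have "dim ?K \<le> dim ?A" by (intro dim_subspace_mono[OF _ AU]) auto
    finally show ?thesis using J(2) by simp
  qed
  \<comment> \<open>Intersecting the annihilator with \<open>P\<close> costs at most 4 dimensions
    and lands in the part of \<open>R\<close> on which \<open>?f\<close> vanishes. That part is a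
    proper subspace of \<open>R\<close>, which sharpens the bound by one.\<close>
  moreover have "Suc (dim ?A) \<le> dim R + 4"
  proof -
    let ?f = "\<lambda>v. cd_dot (Suc n) (cd_mult (Suc n) \<alpha> v) cd_one"
    have "dim ?A \<le> dim {v \<in> ?A. \<forall>j\<in>J. coord v j = 0} + card J"
      by (rule dim_le_dim_kernel_add_card[OF _ AU subA J(1) linear_coord]) simp
    moreover have "dim {v \<in> ?A. \<forall>j\<in>J. coord v j = 0} \<le> dim {v \<in> R. ?f v = 0}"
      by (rule dim_subspace_mono[where B = ?U])
        (use RU in \<open>auto simp: R_def P_def cd_Ann_def cd_dot_simps\<close>)
    moreover have "dim R = Suc (dim {v \<in> R. ?f v = 0})"
    proof (rule dim_linear_kernel[OF _ RU subR linear_cd_dot_mult(1)])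
      have 0: "0 \<in> cd_C_perp n" by (rule subspace_0[OF subspace_cd_C_perp[OF n]])
      \<comment> \<open>Exchanging the two equal factors changes the sign by antisymmetry. Hence
        \<open>cd_brace n a 0\<close> lies in \<open>R\<close>, while \<open>?f\<close> takes the
        non-zero value \<open>- cd_dot n a a\<close> on it.\<close>
      have sq: "cd_dot n (cd_mult n a a) y = 0" if "y \<in> cd_C_perp n" for y
        using cd_triple_skew(2)[OF n a a that] by simp
      show "cd_brace n a 0 \<in> R"
        using a 0 by (auto simp: R_def P \<alpha>_def cd_dot_mult_brace[OF n a b] cd_mult_simps cd_dot_simps sq)
      have "?f (cd_brace n a 0) = - cd_dot (Suc n) (cd_brace n a 0) \<alpha>"
        using cd_dot_imaginary[OF \<alpha>(2,3), of "cd_brace n a 0" cd_one]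
          cd_brace_in_carrier[OF n car[OF a] car[OF 0]] cd_mult_one[OF \<alpha>(2)]
        by (simp add: cd_one_in_carrier)
      also have "\<dots> = - cd_dot n a a"
        unfolding \<alpha>_def using car[OF a] car[OF b] car[OF 0] by (simp add: cd_dot_brace[OF n] cd_dot_simps)
      finally show "?f (cd_brace n a 0) \<noteq> 0"
        using assms(3) cd_dot_self_eq_0_iff[OF car[OF a]] by simp
    qed simp
    ultimately show ?thesis using J(2) by linarith
  qed
  moreover have "4 dvd dim ?A" "4 dvd dim (cd_Ann n a)" "4 dvd dim (cd_Ann n b)"
    using dim_cd_Ann_dvd_4 \<alpha>(1) a b assms(1) by simp_all
  \<comment> \<open>Writing \<open>s\<close> for the sum of the two smaller annihilator dimensions,
    \<open>dim R = s + 4\<close> gives \<open>s \<le> dim ?A \<le> s + 7\<close>; divisibility by 4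
    leaves only \<open>s\<close> and \<open>s + 4\<close>.\<close>
  ultimately show ?thesis
    unfolding \<alpha>_def[symmetric] using dimR by (elim dvdE) presburger
qed

end
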